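(* Let $F$ be a field of characteristic zero and let $\mathbb M=M_{1,1}(F)$ be the algebra of $2\times 2$ matrices over $F$ with its canonical $\mathbb Z_2$-grading and the transpose superinvolution. Then the $T_2^*$-ideal $Id^*(\mathbb M)$ of $*$-identities of $\mathbb M$ is generated, as a $T_2^*$-ideal, by the following polynomials: (1) $[y_{1,0},x]$ with $x\in\{y_{2,0},\,y_{1,1},\,z_{1,0},\,z_{1,1}\}$; (2) $y_{1,1}y_{2,1}$; (3) $z_{1,1}z_{2,1}$; (4) $[z_{1,0},z_{2,0}]$; (5) $z_{1,0}\circ z_{1,1}$; (6) $z_{1,0}\circ y_{1,1}$.
   Context: A superalgebra is an associative $F$-algebra $A=A^{(0)}\oplus A^{(1)}$ with $A^{(i)}A^{(j)}\subseteq A^{(i+j \bmod 2)}$; for homogeneous $a\in A^{(i)}$ write $|a|=i$. A superinvolution on $A$ is a linear map $*:A\to A$ with $(A^{(i)})^*=A^{(i)}$, $(a^* )^*=a$ for all $a$, and $(ab)^*=(-1)^{|a||b|}b^*a^*$ for homogeneous $a,b$. A superalgebra with superinvolution is called a $*$-algebra. Put $(A^{(i)})^{+}=\{a\in A^{(i)}:a^*=a\}$ and $(A^{(i)})^{-}=\{a\in A^{(i)}:a^*=-a\}$. $\mathbb M=M_{1,1}(F)$ is $M_2(F)$ with even part $\mathrm{span}\{e_{11},e_{22}\}$, odd part $\mathrm{span}\{e_{12},e_{21}\}$, and superinvolution $\begin{pmatrix}a&c\\d&b\end{pmatrix}^{*}=\begin{pmatrix}b&-c\\d&a\end{pmatrix}$.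 Thus $(\mathbb M^{(0)})^+=F(e_{11}+e_{22})$, $(\mathbb M^{(0)})^-=F(e_{11}-e_{22})$, $(\mathbb M^{(1)})^+=Fe_{21}$, $(\mathbb M^{(1)})^-=Fe_{12}$. Let $\mathcal F=F\langle X|*\rangle$ be the free associative (unital) algebra on the non-commuting variables $y_{i,0},z_{i,0},y_{i,1},z_{i,1}$ ($i\ge 1$), graded by letting $y_{i,0},z_{i,0}$ have degree $0$ and $y_{i,1},z_{i,1}$ have degree $1$, with the superinvolution $*$ determined by $y_{i,j}^*=y_{i,j}$, $z_{i,j}^*=-z_{i,j}$. Elements of $\mathcal F$ are called $*$-polynomials. Write $[a,b]=ab-ba$ and $a\circ b=ab+ba$. A $*$-polynomial $f$ is a $*$-identity of a $*$-algebra $A$ if $f$ vanishes under every substitution of the variables $y_{i,0},z_{i,0},y_{i,1},z_{i,1}$ by elements of $(A^{(0)})^+,(A^{(0)})^-,(A^{(1)})^+,(A^{(1)})^-$ respectively. $Id^*(A)$ is the set of $*$-identities of $A$. A $T_2^*$-ideal is a two-sided ideal of $\mathcal F$ invariant under all graded (degree-preserving) algebra endomorphisms of $\mathcal F$ that commute with $*$; the $T_2^*$-ideal generated by a set $S\subseteq\mathcal F$ is the smallest $T_2^*$-ideal containing $S$. *)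

theory Defs
  imports
    "HOL-Analysis.Cartesian_Space"
    "HOL-Library.Poly_Mapping"
    "HOL-Library.Z2"
    "HOL.Hull"
begin

section \<open>Superalgebras with superinvolution\<close>

text \<open>
  The additive group of an algebra is the one of its type; the remaining operations are record
  fields.  In particular the product of a matrix algebra on \<open>'k^'n^'n\<close> is not the
  componentwise \<open>*\<close> of that type.  Degrees live in the two-element field \<open>bit\<close>.
\<close>

record ('k, 'a) salgebra =
  scale :: "'k \<Rightarrow> 'a \<Rightarrow> 'a"
  mult :: "'a \<Rightarrow> 'a \<Rightarrow> 'a"
  unit :: 'a
  part :: "bit \<Rightarrow> 'a set"
  star :: "'a \<Rightarrow> 'a"

definition koszul :: "bit \<Rightarrow> bit \<Rightarrow> 'k::field" where
  "koszul i j = (if i = 1 \<and> j = 1 then - 1 else 1)"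

locale star_algebra = vector_space "scale A"
  for A :: "('k::field, 'a::ab_group_add) salgebra" +
  assumes mult_assoc: "mult A (mult A a b) c = mult A a (mult A b c)"
    and mult_unit_left: "mult A (unit A) a = a"
    and mult_unit_right: "mult A a (unit A) = a"
    and mult_add_left: "mult A (a + b) c = mult A a c + mult A b c"
    and mult_add_right: "mult A a (b + c) = mult A a b + mult A a c"
    and mult_scale_left: "mult A (scale A r a) b = scale A r (mult A a b)"
    and mult_scale_right: "mult A a (scale A r b) = scale A r (mult A a b)"
    and part_subspace: "subspace (part A i)"
    and part_direct_sum: "\<exists>!p. fst p \<in> part A 0 \<and> snd p \<in> part A 1 \<and> a = fst p + snd p"
    and part_mult: "a \<in> part A i \<Longrightarrow> b \<in> part A j \<Longrightarrow> mult A a b \<in> part A (i + j)"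
    and star_linear: "Vector_Spaces.linear (scale A) (scale A) (star A)"
    and star_part: "star A ` part A i = part A i"
    and star_star: "star A (star A a) = a"
    and star_mult: "a \<in> part A i \<Longrightarrow> b \<in> part A j \<Longrightarrow>
      star A (mult A a b) = scale A (koszul i j) (mult A (star A b) (star A a))"

definition symmetric_part :: "('k, 'a::ab_group_add) salgebra \<Rightarrow> bit \<Rightarrow> 'a set" where
  "symmetric_part A i = {a \<in> part A i. star A a = a}"

definition skew_part :: "('k, 'a::ab_group_add) salgebra \<Rightarrow> bit \<Rightarrow> 'a set" where
  "skew_part A i = {a \<in> part A i. star A a = - a}"

definition star_hom ::
  "('k::field, 'a::ab_group_add) salgebra \<Rightarrow> ('k, 'b::ab_group_add) salgebra \<Rightarrow> ('a \<Rightarrow> 'b) \<Rightarrow> bool"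
  where "star_hom A B h \<longleftrightarrow>
    Vector_Spaces.linear (scale A) (scale B) h \<and>
    (\<forall>a b. h (mult A a b) = mult B (h a) (h b)) \<and> h (unit A) = unit B \<and>
    (\<forall>i. h ` part A i \<subseteq> part B i) \<and>
    (\<forall>a. h (star A a) = star B (h a))"


section \<open>The free algebra with superinvolution\<close>

text \<open>
  \<open>Y i j\<close> and \<open>Z i j\<close> stand for the symmetric and skew variables of degree \<open>j\<close> and index
  \<open>i + 1\<close>, so that indices starting from \<open>1\<close> become natural numbers starting from \<open>0\<close>.
\<close>

datatype var = Y nat bit | Z nat bit

fun var_degree :: "var \<Rightarrow> bit" where
  "var_degree (Y i j) = j"
| "var_degree (Z i j) = j"

fun var_sign :: "var \<Rightarrow> 'k::field" where
  "var_sign (Y i j) = 1"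
| "var_sign (Z i j) = - 1"

text \<open>
  The free monoid on the variables, written additively as required by \<^theory>\<open>HOL-Library.Poly_Mapping\<close>,
  whose convolution product makes \<open>word \<Rightarrow>\<^sub>0 'k\<close> the monoid algebra, that is, the free
  associative unital algebra.
\<close>

datatype word = Word (letters: "var list")

instantiation word :: monoid_add
begin

definition zero_word :: word where "zero_word = Word []"

definition plus_word :: "word \<Rightarrow> word \<Rightarrow> word" where
  "plus_word u v = Word (letters u @ letters v)"

instance
  by standard (simp_all add: zero_word_def plus_word_def)

end

type_synonym 'k star_poly = "word \<Rightarrow>\<^sub>0 'k"

definition word_degree :: "word \<Rightarrow> bit" where
  "word_degree w = sum_list (map var_degree (letters w))"

text \<open>
  \<open>(x\<^sub>1 \<dots> x\<^sub>n)\<^sup>* = star_sign [x\<^sub>1, \<dots>, x\<^sub>n] x\<^sub>n \<dots> x\<^sub>1\<close>; the recursion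
  is \<open>(x w)\<^sup>* = koszul (deg x) (deg w) w\<^sup>* x\<^sup>*\<close>.
\<close>

fun star_sign :: "var list \<Rightarrow> 'k::field" where
  "star_sign [] = 1"
| "star_sign (x # xs) =
     koszul (var_degree x) (word_degree (Word xs)) * var_sign x * star_sign xs"

definition star_poly_star :: "'k::field star_poly \<Rightarrow> 'k star_poly" where
  "star_poly_star f = (\<Sum>w\<in>Poly_Mapping.keys f.
     Poly_Mapping.single (Word (rev (letters w)))
       (star_sign (letters w) * Poly_Mapping.lookup f w))"

definition free_star_algebra :: "('k::field, 'k star_poly) salgebra" where
  "free_star_algebra = \<lparr>
     scale = (\<lambda>c f. Poly_Mapping.single 0 c * f),
     mult = (*),
     unit = 1,
     part = (\<lambda>i. {f. \<forall>w\<in>Poly_Mapping.keys f. word_degree w = i}),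
     star = star_poly_star\<rparr>"

definition var_poly :: "var \<Rightarrow> 'k::field star_poly" where
  "var_poly x = Poly_Mapping.single (Word [x]) 1"

abbreviation yv :: "nat \<Rightarrow> bit \<Rightarrow> 'k::field star_poly" where "yv i j \<equiv> var_poly (Y i j)"
abbreviation zv :: "nat \<Rightarrow> bit \<Rightarrow> 'k::field star_poly" where "zv i j \<equiv> var_poly (Z i j)"

definition commutator :: "'a::ring \<Rightarrow> 'a \<Rightarrow> 'a" where
  "commutator a b = a * b - b * a"

definition anticommutator :: "'a::ring \<Rightarrow> 'a \<Rightarrow> 'a" where
  "anticommutator a b = a * b + b * a"


section \<open>Identities and T-ideals\<close>

definition admissible :: "('k, 'a::ab_group_add) salgebra \<Rightarrow> (var \<Rightarrow> 'a) \<Rightarrow> bool" where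
  "admissible A \<phi> \<longleftrightarrow>
     (\<forall>i j. \<phi> (Y i j) \<in> symmetric_part A j \<and> \<phi> (Z i j) \<in> skew_part A j)"

definition eval_word :: "('k, 'a) salgebra \<Rightarrow> (var \<Rightarrow> 'a) \<Rightarrow> word \<Rightarrow> 'a" where
  "eval_word A \<phi> w = foldr (mult A) (map \<phi> (letters w)) (unit A)"

definition eval_poly ::
  "('k::field, 'a::ab_group_add) salgebra \<Rightarrow> (var \<Rightarrow> 'a) \<Rightarrow> 'k star_poly \<Rightarrow> 'a" where
  "eval_poly A \<phi> f =
     (\<Sum>w\<in>Poly_Mapping.keys f. scale A (Poly_Mapping.lookup f w) (eval_word A \<phi> w))"

definition star_identities :: "('k::field, 'a::ab_group_add) salgebra \<Rightarrow> 'k star_poly set" where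
  "star_identities A = {f. \<forall>\<phi>. admissible A \<phi> \<longrightarrow> eval_poly A \<phi> f = 0}"

definition two_sided_ideal :: "'a::ring_1 set \<Rightarrow> bool" where
  "two_sided_ideal I \<longleftrightarrow>
     0 \<in> I \<and> (\<forall>f\<in>I. \<forall>g\<in>I. f + g \<in> I) \<and> (\<forall>f\<in>I. \<forall>g. g * f \<in> I \<and> f * g \<in> I)"

definition T2_ideal :: "'k::field star_poly set \<Rightarrow> bool" where
  "T2_ideal I \<longleftrightarrow> two_sided_ideal I \<and>
     (\<forall>h. star_hom free_star_algebra free_star_algebra h \<longrightarrow> h ` I \<subseteq> I)"


section \<open>The algebra \<open>M\<^sub>1\<^sub>,\<^sub>1\<close>\<close>

definition mat2 :: "'k::field \<Rightarrow> 'k \<Rightarrow> 'k \<Rightarrow> 'k \<Rightarrow> 'k^2^2" where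
  "mat2 a c d b = vector [vector [a, c], vector [d, b]]"

definition M11 :: "('k::field, 'k^2^2) salgebra" where
  "M11 = \<lparr>
     scale = (\<lambda>r A. \<chi> i j. r * A $ i $ j),
     mult = (**),
     unit = mat 1,
     part = (\<lambda>i. if i = 0 then {mat2 a 0 0 b | a b. True} else {mat2 0 c d 0 | c d. True}),
     star = (\<lambda>A. mat2 (A $ 2 $ 2) (- A $ 1 $ 2) (A $ 2 $ 1) (A $ 1 $ 1))\<rparr>"


section \<open>Both algebras satisfy the axioms\<close>

lemma mat2_nth [simp]:
  "mat2 a c d b $ 1 $ 1 = a" "mat2 a c d b $ 1 $ 2 = c"
  "mat2 a c d b $ 2 $ 1 = d" "mat2 a c d b $ 2 $ 2 = b"
  by (simp_all add: mat2_def)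

lemma mat2_eq_iff: "A = B \<longleftrightarrow> A $ 1 $ 1 = B $ 1 $ 1 \<and> A $ 1 $ 2 = B $ 1 $ 2 \<and>
    A $ 2 $ 1 = B $ 2 $ 1 \<and> A $ 2 $ 2 = B $ 2 $ 2" for A B :: "'k^2^2"
  by (auto simp: vec_eq_iff forall_2)

lemma M11_star_mat2: "star M11 (mat2 a c d b) = mat2 b (- c) d a"
  by (simp add: M11_def)

lemma bit_cases: obtains "(i::bit) = 0" | "i = 1"
  using bit_not_one_iff by blast

lemma M11_part0: "part M11 0 = {A. A $ 1 $ 2 = 0 \<and> A $ 2 $ 1 = 0}"
  by (auto simp: M11_def mat2_eq_iff)

lemma M11_part1: "part M11 1 = {A. A $ 1 $ 1 = 0 \<and> A $ 2 $ 2 = 0}"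
  by (auto simp: M11_def mat2_eq_iff)

lemma M11_sel:
  "scale M11 r A = (\<chi> i j. r * A $ i $ j)" "mult M11 = (**)" "unit M11 = mat 1"
  "star M11 A = mat2 (A $ 2 $ 2) (- A $ 1 $ 2) (A $ 2 $ 1) (A $ 1 $ 1)"
  by (simp_all add: M11_def)

lemma matrix_mult_2:
  "(A ** B) $ i $ j = A $ i $ 1 * B $ 1 $ j + A $ i $ 2 * B $ 2 $ j" for A B :: "'k::field^2^2"
  by (simp add: matrix_matrix_mult_def sum_2)

lemma vector_space_M11: "vector_space (scale (M11 :: ('k::field, 'k^2^2) salgebra))"
  by unfold_locales (auto simp: M11_sel mat2_eq_iff algebra_simps)

lemma image_involution:
  assumes "\<And>a. a \<in> S \<Longrightarrow> f a \<in> S" "\<And>a. f (f a) = a"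
  shows "f ` S = S"
proof
  show "S \<subseteq> f ` S"
  proof
    fix a assume "a \<in> S"
    then show "a \<in> f ` S" using assms by (intro image_eqI[of a f "f a"]) auto
  qed
qed (use assms in auto)

theorem star_algebra_M11: "star_algebra (M11 :: ('k::field, 'k^2^2) salgebra)"
proof -
  interpret vector_space "scale (M11 :: ('k, 'k^2^2) salgebra)" by (rule vector_space_M11)
  have star_part: "star M11 a \<in> part M11 i" if "a \<in> part M11 i" for a :: "'k^2^2" and i
    using that by (cases i rule: bit_cases) (simp_all add: M11_part0 M11_part1 M11_sel)
  have star_star: "star M11 (star M11 a) = a" for a :: "'k^2^2"
    by (simp add: M11_sel mat2_eq_iff)
  show ?thesis
  proof
    fix a b c :: "'k^2^2" and r :: 'k and i j
    show "mult M11 (mult M11 a b) c = mult M11 a (mult M11 b c)"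
      by (simp add: M11_sel matrix_mul_assoc)
    show "mult M11 (unit M11) a = a" "mult M11 a (unit M11) = a"
      by (simp_all add: M11_sel)
    show "mult M11 (a + b) c = mult M11 a c + mult M11 b c"
      "mult M11 a (b + c) = mult M11 a b + mult M11 a c"
      "mult M11 (scale M11 r a) b = scale M11 r (mult M11 a b)"
      "mult M11 a (scale M11 r b) = scale M11 r (mult M11 a b)"
      by (simp_all add: M11_sel mat2_eq_iff matrix_mult_2 algebra_simps)
    show "subspace (part M11 i :: ('k^2^2) set)"
      by (cases i rule: bit_cases) (auto simp: subspace_def M11_part0 M11_part1 M11_sel)
    show "\<exists>!p. fst p \<in> part M11 0 \<and> snd p \<in> part M11 1 \<and> a = fst p + snd p"
      by (rule ex1I[of _ "(mat2 (a $ 1 $ 1) 0 0 (a $ 2 $ 2), mat2 0 (a $ 1 $ 2) (a $ 2 $ 1) 0)"])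
        (auto simp: M11_part0 M11_part1 mat2_eq_iff prod_eq_iff)
    show "mult M11 a b \<in> part M11 (i + j)" if "a \<in> part M11 i" "b \<in> part M11 j"
      using that by (cases i rule: bit_cases; cases j rule: bit_cases)
        (simp_all add: M11_part0 M11_part1 M11_sel matrix_mult_2)
    show "star M11 (a + b) = star M11 a + star M11 b"
      "star M11 (scale M11 r a) = scale M11 r (star M11 a)"
      by (simp_all add: M11_sel mat2_eq_iff)
    show "star M11 ` part M11 i = (part M11 i :: ('k^2^2) set)"
      using star_part star_star by (rule image_involution)
    show "star M11 (star M11 a) = a" by (rule star_star)
    show "star M11 (mult M11 a b) = scale M11 (koszul i j) (mult M11 (star M11 b) (star M11 a))"
      if "a \<in> part M11 i" "b \<in> part M11 j"
      using that by (cases i rule: bit_cases; cases j rule: bit_cases)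
        (simp_all add: M11_part0 M11_part1 M11_sel mat2_eq_iff matrix_mult_2 koszul_def)
  qed
qed

lemma M11_parts:
  "symmetric_part (M11 :: ('k::field_char_0, 'k^2^2) salgebra) 0 = {mat2 a 0 0 a | a. True}"
  "skew_part (M11 :: ('k::field_char_0, 'k^2^2) salgebra) 0 = {mat2 a 0 0 (- a) | a. True}"
  "symmetric_part (M11 :: ('k::field_char_0, 'k^2^2) salgebra) 1 = {mat2 0 0 d 0 | d. True}"
  "skew_part (M11 :: ('k::field_char_0, 'k^2^2) salgebra) 1 = {mat2 0 c 0 0 | c. True}"
  unfolding symmetric_part_def skew_part_def
  by (auto simp: M11_part0 M11_part1 M11_sel mat2_eq_iff eq_neg_iff_add_eq_0 add.commute)

lemma free_sel:
  "scale free_star_algebra c f = Poly_Mapping.single 0 c * f"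
  "mult free_star_algebra = (*)" "unit free_star_algebra = 1"
  "part free_star_algebra i = {f. \<forall>w\<in>Poly_Mapping.keys f. word_degree w = i}"
  "star free_star_algebra = star_poly_star"
  by (simp_all add: free_star_algebra_def)

lemma word_degree_add: "word_degree (u + v) = word_degree u + word_degree v"
  by (simp add: word_degree_def plus_word_def del: add_bit_eq_xor)

lemma word_degree_simps:
  "word_degree (Word []) = 0"
  "word_degree (Word (x # xs)) = var_degree x + word_degree (Word xs)"
  "word_degree (Word (xs @ ys)) = word_degree (Word xs) + word_degree (Word ys)"
  by (simp_all add: word_degree_def del: add_bit_eq_xor)

lemma word_degree_rev: "word_degree (Word (rev xs)) = word_degree (Word xs)"
  by (induction xs) (simp_all add: word_degree_simps add.commute del: add_bit_eq_xor)

lemma sum_singles: "f = (\<Sum>w\<in>Poly_Mapping.keys f. Poly_Mapping.single w (Poly_Mapping.lookup f w))"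
  by (rule poly_mapping_eqI)
    (simp add: lookup_sum lookup_single when_def in_keys_iff sum.delta' if_distrib cong: if_cong)

lemma poly_induct [case_names zero add single]:
  fixes f :: "'a \<Rightarrow>\<^sub>0 'b::comm_monoid_add"
  assumes "P 0" and add: "\<And>f g. P f \<Longrightarrow> P g \<Longrightarrow> P (f + g)"
    and single: "\<And>w c. w \<in> Poly_Mapping.keys f \<Longrightarrow> P (Poly_Mapping.single w c)"
  shows "P f"
proof -
  have "P (\<Sum>w\<in>S. Poly_Mapping.single w (Poly_Mapping.lookup f w))"
    if "finite S" "S \<subseteq> Poly_Mapping.keys f" for S
    using that by (induction S rule: finite_induct) (simp_all add: assms)
  then show ?thesis
    by (subst sum_singles) auto
qed

lemma scalar_central:
  "Poly_Mapping.single (0::word) (c::'k::field) * f = f * Poly_Mapping.single 0 c"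
  by (induction f rule: poly_induct) (simp_all add: algebra_simps mult_single)

lemma star_single:
  "star_poly_star (Poly_Mapping.single w c) =
   Poly_Mapping.single (Word (rev (letters w))) (star_sign (letters w) * c)"
  by (simp add: star_poly_star_def)

lemma star_superset:
  assumes "finite S" "Poly_Mapping.keys f \<subseteq> S"
  shows "star_poly_star f = (\<Sum>w\<in>S. Poly_Mapping.single (Word (rev (letters w)))
       (star_sign (letters w) * Poly_Mapping.lookup f w))"
  unfolding star_poly_star_def
  by (rule sum.mono_neutral_left) (use assms in \<open>auto simp: in_keys_iff\<close>)

lemma star_add: "star_poly_star (f + g) = star_poly_star f + star_poly_star g"
proof -
  let ?S = "Poly_Mapping.keys f \<union> Poly_Mapping.keys g"
  have "Poly_Mapping.keys (f + g) \<subseteq> ?S" by (rule keys_add)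
  then show ?thesis
    by (simp add: star_superset[of ?S] lookup_add distrib_left single_add sum.distrib)
qed

lemma star_zero: "star_poly_star 0 = 0"
  by (simp add: star_poly_star_def)

lemma star_scalar:
  "star_poly_star (Poly_Mapping.single 0 c * f) = Poly_Mapping.single 0 c * star_poly_star f"
  by (induction f rule: poly_induct)
    (simp_all add: star_zero star_add star_single distrib_left mult_single mult_ac)

lemma koszul_add_left: "koszul (i + j) k = koszul i k * koszul j k"
  by (cases i rule: bit_cases; cases j rule: bit_cases) (simp_all add: koszul_def)

lemma koszul_sym: "koszul i j = koszul j i"
  by (auto simp: koszul_def)

lemma koszul_square: "koszul i j * koszul i j = 1"
  by (simp add: koszul_def)

lemma koszul_zero: "koszul 0 j = 1"
  by (simp add: koszul_def)

lemma koszul_add_right: "koszul i (j + k) = koszul i j * koszul i k"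
  by (metis koszul_add_left koszul_sym)

lemma star_sign_append: "star_sign (xs @ ys) =
    koszul (word_degree (Word xs)) (word_degree (Word ys)) * star_sign xs * star_sign ys"
  by (induction xs)
    (simp_all add: word_degree_simps koszul_add_left koszul_add_right koszul_zero mult_ac
      del: add_bit_eq_xor)

lemma var_sign_square: "var_sign x * var_sign x = 1"
  by (cases x) simp_all

lemma star_sign_rev: "star_sign (rev xs) * star_sign xs = 1"
proof (induction xs)
  case (Cons x xs)
  let ?k = "koszul (var_degree x) (word_degree (Word xs)) :: 'a"
  have k: "koszul (word_degree (Word xs)) (var_degree x) = ?k" by (rule koszul_sym)
  have "star_sign (rev (x # xs)) * star_sign (x # xs) =
      (?k * ?k) * (var_sign x * var_sign x) * (star_sign (rev xs) * star_sign xs)"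
    by (simp add: star_sign_append word_degree_rev word_degree_simps koszul_zero
        koszul_sym[of _ 0] k mult_ac del: add_bit_eq_xor)
  then show ?case by (simp only: Cons koszul_square var_sign_square mult_1)
qed simp

lemma star_star_poly: "star_poly_star (star_poly_star f) = f"
  by (induction f rule: poly_induct)
    (simp_all add: star_zero star_add star_single star_sign_rev flip: mult.assoc)

lemma star_mult_poly:
  assumes f: "\<forall>w\<in>Poly_Mapping.keys f. word_degree w = i"
    and g: "\<forall>w\<in>Poly_Mapping.keys g. word_degree w = j"
  shows "star_poly_star (f * g) =
    Poly_Mapping.single 0 (koszul i j) * (star_poly_star g * star_poly_star f)"
proof -
  have one: "star_poly_star (Poly_Mapping.single u a * Poly_Mapping.single v b) =
    Poly_Mapping.single 0 (koszul i j) *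
      (star_poly_star (Poly_Mapping.single v b) * star_poly_star (Poly_Mapping.single u a))"
    if "u \<in> Poly_Mapping.keys f" "v \<in> Poly_Mapping.keys g" for u v a b
    using that f g
    by (cases u; cases v)
      (auto simp: mult_single star_single plus_word_def zero_word_def star_sign_append mult_ac)
  have two: "star_poly_star (Poly_Mapping.single u a * g) =
    Poly_Mapping.single 0 (koszul i j) * (star_poly_star g * star_poly_star (Poly_Mapping.single u a))"
    if "u \<in> Poly_Mapping.keys f" for u a
    by (induction g rule: poly_induct)
      (simp_all add: star_zero star_add one that distrib_left distrib_right)
  show ?thesis
    by (induction f rule: poly_induct)
      (simp_all add: star_zero star_add two distrib_left distrib_right)
qed

lemma lookup_scalar: "Poly_Mapping.lookup (Poly_Mapping.single 0 c * f) w = c * Poly_Mapping.lookup f w"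
  for f :: "'k::field star_poly"
  by (auto simp: Poly_Mapping.map.rep_eq when_def simp flip: mult_map_scale_conv_mult)

lemma vector_space_free:
  "vector_space (scale (free_star_algebra :: ('k::field, 'k star_poly) salgebra))"
  by unfold_locales
    (simp_all add: free_sel distrib_left distrib_right single_add mult_single flip: mult.assoc)

theorem star_algebra_free:
  "star_algebra (free_star_algebra :: ('k::field, 'k star_poly) salgebra)"
proof -
  let ?A = "free_star_algebra :: ('k, 'k star_poly) salgebra"
  interpret vector_space "scale ?A" by (rule vector_space_free)
  have star_part: "star ?A a \<in> part ?A i" if "a \<in> part ?A i" for a i
    unfolding free_sel star_poly_star_def
  proof (intro CollectI ballI)
    fix w assume "w \<in> Poly_Mapping.keys (\<Sum>w\<in>Poly_Mapping.keys a.
      Poly_Mapping.single (Word (rev (letters w)))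
       (star_sign (letters w) * Poly_Mapping.lookup a w))"
    then obtain v where "v \<in> Poly_Mapping.keys a" "w = Word (rev (letters v))"
      using keys_sum by (fastforce split: if_splits)
    then show "word_degree w = i"
      using that by (cases v) (auto simp: free_sel word_degree_rev)
  qed
  have star_star: "star ?A (star ?A a) = a" for a
    by (simp add: free_sel star_star_poly)
  show ?thesis
  proof
    fix a b c :: "'k star_poly" and r :: 'k and i j
    show "mult ?A (mult ?A a b) c = mult ?A a (mult ?A b c)"
      "mult ?A (unit ?A) a = a" "mult ?A a (unit ?A) = a"
      "mult ?A (a + b) c = mult ?A a c + mult ?A b c"
      "mult ?A a (b + c) = mult ?A a b + mult ?A a c"
      "mult ?A (scale ?A r a) b = scale ?A r (mult ?A a b)"
      by (simp_all add: free_sel mult.assoc distrib_left distrib_right)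
    show "mult ?A a (scale ?A r b) = scale ?A r (mult ?A a b)"
      by (simp add: free_sel scalar_central mult.assoc)
    show "subspace (part ?A i)"
      using keys_add by (fastforce simp: subspace_def free_sel in_keys_iff lookup_scalar)
    show "\<exists>!p. fst p \<in> part ?A 0 \<and> snd p \<in> part ?A 1 \<and> a = fst p + snd p"
    proof -
      define p where "p i = (\<Sum>w | w \<in> Poly_Mapping.keys a \<and> word_degree w = i.
        Poly_Mapping.single w (Poly_Mapping.lookup a w))" for i
      have lookup_p: "Poly_Mapping.lookup (p i) w =
          (if word_degree w = i then Poly_Mapping.lookup a w else 0)" for i w
        by (auto simp: p_def lookup_sum lookup_single when_def in_keys_iff)
      show ?thesis
      proof (rule ex1I[of _ "(p 0, p 1)"], goal_cases)
        case 1
        show ?case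
          by (auto simp: free_sel in_keys_iff lookup_p lookup_add intro!: poly_mapping_eqI
              split: if_splits)
      next
        case (2 q)
        then have "\<forall>w\<in>Poly_Mapping.keys (fst q). word_degree w = 0"
          "\<forall>w\<in>Poly_Mapping.keys (snd q). word_degree w = 1"
          by (auto simp: free_sel)
        then have q: "word_degree w = 1 \<Longrightarrow> Poly_Mapping.lookup (fst q) w = 0"
          and q': "word_degree w = 0 \<Longrightarrow> Poly_Mapping.lookup (snd q) w = 0" for w
          by (force simp: not_in_keys_iff_lookup_eq_zero[symmetric])+
        from 2 have a: "a = fst q + snd q" by simp
        show ?case
        proof (rule prod_eqI; rule poly_mapping_eqI)
          fix w
          have p: "Poly_Mapping.lookup (p i) w = (if word_degree w = i
              then Poly_Mapping.lookup (fst q) w + Poly_Mapping.lookup (snd q) w else 0)" for i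
            using a by (simp add: lookup_p flip: lookup_add)
          show "Poly_Mapping.lookup (fst q) w = Poly_Mapping.lookup (fst (p 0, p 1)) w"
            by (cases "word_degree w" rule: bit_cases) (use q[of w] q'[of w] in \<open>simp_all add: p\<close>)
          show "Poly_Mapping.lookup (snd q) w = Poly_Mapping.lookup (snd (p 0, p 1)) w"
            by (cases "word_degree w" rule: bit_cases) (use q[of w] q'[of w] in \<open>simp_all add: p\<close>)
        qed
      qed
    qed
    show "mult ?A a b \<in> part ?A (i + j)" if "a \<in> part ?A i" "b \<in> part ?A j"
      using that keys_mult[of a b]
      by (auto simp: free_sel word_degree_add simp del: add_bit_eq_xor)
    show "star ?A (a + b) = star ?A a + star ?A b"
      "star ?A (scale ?A r a) = scale ?A r (star ?A a)"
      by (simp_all add: free_sel star_add star_scalar)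
    show "star ?A ` part ?A i = part ?A i"
      using star_part star_star by (rule image_involution)
    show "star ?A (star ?A a) = a" by (rule star_star)
    show "star ?A (mult ?A a b) = scale ?A (koszul i j) (mult ?A (star ?A b) (star ?A a))"
      if "a \<in> part ?A i" "b \<in> part ?A j"
      using that by (simp add: free_sel star_mult_poly)
  qed
qed

lemma var_poly_parts:
  "var_poly (Y i j) \<in> symmetric_part free_star_algebra j"
  "var_poly (Z i j) \<in> skew_part free_star_algebra j"
  by (simp_all add: symmetric_part_def skew_part_def free_sel var_poly_def star_single
      word_degree_def koszul_def single_uminus)

end

theory Submission
  imports "HOL-Library.Multiset" Defs
begin

text \<open>
  Modulo the relations, even letters can be moved to the front and sorted, up to sign, and an odd
  word vanishes unless symmetric and skew letters alternate.  Since \<open>y z + z y\<close> is symmetric of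
  degree \<open>0\<close> for odd \<open>y\<close> symmetric and \<open>z\<close> skew, it is central, which allows the symmetric
  letters of an alternating word to be permuted among themselves, and likewise the skew ones.  So
  for a fixed multiset of letters at most two words survive, starting with a symmetric or with a
  skew odd letter.  On multiples of \<open>I\<close>, \<open>e\<^sub>1\<^sub>1 - e\<^sub>2\<^sub>2\<close>, \<open>e\<^sub>2\<^sub>1\<close> and \<open>e\<^sub>1\<^sub>2\<close> their values live in
  different rows, so they are linearly independent; different multisets of letters are separated by
  the independence of monomials over an infinite field.
\<close>

section \<open>Evaluation is a homomorphism\<close>

lemma star_hom_free_iff:
  "star_hom free_star_algebra A h \<longleftrightarrow> vector_space (scale A) \<and>
    (\<forall>f g. h (f + g) = h f + h g) \<and>
    (\<forall>c f. h (Poly_Mapping.single 0 c * f) = scale A c (h f)) \<and>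
    (\<forall>f g. h (f * g) = mult A (h f) (h g)) \<and> h 1 = unit A \<and>
    (\<forall>i. \<forall>f\<in>part free_star_algebra i. h f \<in> part A i) \<and>
    (\<forall>f. h (star_poly_star f) = star A (h f))"
  using vector_space_free
  by (auto simp: star_hom_def Vector_Spaces.linear_iff free_sel(1-3,5) image_subset_iff)

lemma star_hom_comp: "star_hom A B g \<Longrightarrow> star_hom B C h \<Longrightarrow> star_hom A C (h \<circ> g)"
  by (auto simp: star_hom_def image_subset_iff intro: Vector_Spaces.linear_compose)

context star_algebra
begin

lemma mult_zero: "mult A 0 a = 0" "mult A a 0 = 0"
  using mult_add_left[of 0 0 a] mult_add_right[of a 0 0] by simp_all

lemma eval_word_simps:
  "eval_word A \<phi> (Word []) = unit A"
  "eval_word A \<phi> (Word (x # xs)) = mult A (\<phi> x) (eval_word A \<phi> (Word xs))"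
  by (simp_all add: eval_word_def)

lemma eval_word_append:
  "eval_word A \<phi> (Word (xs @ ys)) = mult A (eval_word A \<phi> (Word xs)) (eval_word A \<phi> (Word ys))"
  by (induction xs) (simp_all add: eval_word_simps mult_unit_left mult_assoc)

lemma eval_word_plus: "eval_word A \<phi> (u + v) = mult A (eval_word A \<phi> u) (eval_word A \<phi> v)"
  by (cases u; cases v) (simp add: plus_word_def eval_word_append)

lemma eval_superset:
  assumes "finite S" "Poly_Mapping.keys f \<subseteq> S"
  shows "eval_poly A \<phi> f = (\<Sum>w\<in>S. scale A (Poly_Mapping.lookup f w) (eval_word A \<phi> w))"
  unfolding eval_poly_def
  by (rule sum.mono_neutral_left) (use assms in \<open>auto simp: in_keys_iff\<close>)

lemma eval_zero: "eval_poly A \<phi> 0 = 0"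
  by (simp add: eval_poly_def)

lemma eval_single: "eval_poly A \<phi> (Poly_Mapping.single w c) = scale A c (eval_word A \<phi> w)"
  by (simp add: eval_poly_def)

lemma eval_add: "eval_poly A \<phi> (f + g) = eval_poly A \<phi> f + eval_poly A \<phi> g"
proof -
  let ?S = "Poly_Mapping.keys f \<union> Poly_Mapping.keys g"
  have "Poly_Mapping.keys (f + g) \<subseteq> ?S" by (rule keys_add)
  then show ?thesis
    by (simp add: eval_superset[of ?S] lookup_add scale_left_distrib sum.distrib)
qed

lemma eval_mult: "eval_poly A \<phi> (f * g) = mult A (eval_poly A \<phi> f) (eval_poly A \<phi> g)"
proof -
  have "eval_poly A \<phi> (Poly_Mapping.single u a * g) =
      mult A (eval_poly A \<phi> (Poly_Mapping.single u a)) (eval_poly A \<phi> g)" for u a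
    by (induction g rule: poly_induct)
      (simp_all add: eval_zero mult_zero eval_add mult_add_right distrib_left mult_single
        eval_single eval_word_plus mult_scale_left mult_scale_right)
  then show ?thesis
    by (induction f rule: poly_induct)
      (simp_all add: eval_zero mult_zero eval_add mult_add_left distrib_right)
qed

lemma eval_one: "eval_poly A \<phi> 1 = unit A"
  by (simp add: eval_single eval_word_simps zero_word_def flip: single_one)

lemma eval_scale: "eval_poly A \<phi> (Poly_Mapping.single 0 c * f) = scale A c (eval_poly A \<phi> f)"
  by (simp add: eval_mult eval_single zero_word_def eval_word_simps mult_scale_left mult_unit_left)

lemma eval_uminus: "eval_poly A \<phi> (- f) = - eval_poly A \<phi> f"
  using eval_add[of \<phi> f "- f"] by (simp add: eval_zero eq_neg_iff_add_eq_0 add.commute)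

lemma eval_diff: "eval_poly A \<phi> (f - g) = eval_poly A \<phi> f - eval_poly A \<phi> g"
  using eval_add[of \<phi> f "- g"] by (simp add: eval_uminus)

lemma eval_var: "eval_poly A \<phi> (var_poly x) = \<phi> x"
  by (simp add: var_poly_def eval_single eval_word_simps mult_unit_right)

lemma star_zero': "star A 0 = 0"
  and star_add': "star A (a + b) = star A a + star A b"
  and star_scale: "star A (scale A r a) = scale A r (star A a)"
proof -
  show "star A (a + b) = star A a + star A b" "star A (scale A r a) = scale A r (star A a)" for a b r
    using star_linear by (simp_all add: Vector_Spaces.linear_iff)
  from this(1)[of 0 0] show "star A 0 = 0" by simp
qed

text \<open>The axioms do not place the unit in degree \<open>0\<close>. Writing it as
  \<open>e0 + e1\<close>, the odd component \<open>e0 e1\<close> of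
  \<open>e0 = e0 e0 + e0 e1\<close> vanishes, so \<open>e1 = e1 e1\<close> is even as well as odd
  and hence zero.\<close>

lemma unit_part: "unit A \<in> part A 0"
proof -
  obtain e0 e1 where e: "e0 \<in> part A 0" "e1 \<in> part A 1" "unit A = e0 + e1"
    using part_direct_sum[of "unit A"] by auto
  have "mult A e0 e1 \<in> part A 1" "mult A e0 e0 \<in> part A 0"
    using part_mult[OF e(1) e(2)] part_mult[OF e(1) e(1)] by simp_all
  moreover have "e0 = mult A e0 e0 + mult A e0 e1"
    using mult_unit_right[of e0] by (simp add: e mult_add_right)
  moreover have "\<exists>!p. fst p \<in> part A 0 \<and> snd p \<in> part A 1 \<and> e0 = fst p + snd p"
    by (rule part_direct_sum)
  moreover have "0 \<in> part A 1" using part_subspace by (rule subspace_0)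
  ultimately have z: "mult A e0 e1 = 0"
    using e(1) by (metis add.right_neutral fst_conv snd_conv)
  have "e1 = mult A (unit A) e1" by (simp add: mult_unit_left)
  also have "\<dots> = mult A e1 e1" by (simp add: e mult_add_left z)
  finally have "e1 \<in> part A 0"
    using part_mult[OF e(2) e(2)] by simp
  moreover have "0 \<in> part A 0" using part_subspace by (rule subspace_0)
  ultimately have "e1 = 0"
    using e(2) part_direct_sum[of e1] \<open>0 \<in> part A 1\<close>
    by (metis add.right_neutral add_0 fst_conv snd_conv)
  then show ?thesis using e by simp
qed

text \<open>The unit being even, no Koszul sign appears: starring the product of
  \<open>unit A\<close> and \<open>star A (unit A)\<close> gives \<open>unit A\<close> on one side
  and \<open>star A (unit A)\<close> on the other.\<close>

lemma star_unit: "star A (unit A) = unit A"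
proof -
  have u: "unit A \<in> part A 0" by (rule unit_part)
  then have "star A (unit A) \<in> part A 0" using star_part by blast
  from star_mult[OF u this] show ?thesis
    by (simp add: mult_unit_left mult_unit_right star_star koszul_zero)
qed

context
  fixes \<phi>
  assumes adm: "admissible A \<phi>"
begin

lemma admissible_part: "\<phi> x \<in> part A (var_degree x)"
  using adm by (cases x) (auto simp: admissible_def symmetric_part_def skew_part_def)

lemma admissible_star: "star A (\<phi> x) = scale A (var_sign x) (\<phi> x)"
  using adm by (cases x) (auto simp: admissible_def symmetric_part_def skew_part_def)

lemma eval_word_part: "eval_word A \<phi> (Word xs) \<in> part A (word_degree (Word xs))"
  by (induction xs)
    (simp_all add: eval_word_simps word_degree_simps unit_part part_mult admissible_part
      del: add_bit_eq_xor)

lemma eval_part: "f \<in> part free_star_algebra i \<Longrightarrow> eval_poly A \<phi> f \<in> part A i"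
  unfolding eval_poly_def
  by (intro subspace_sum[OF part_subspace] subspace_scale[OF part_subspace])
    (metis (mono_tags, lifting) eval_word_part free_sel(4) mem_Collect_eq word.collapse)

text \<open>Peeling off the first letter with \<open>star_mult\<close> yields the recursion that
  defines \<open>star_sign\<close>.\<close>

lemma star_eval_word:
  "star A (eval_word A \<phi> (Word xs)) = scale A (star_sign xs) (eval_word A \<phi> (Word (rev xs)))"
proof (induction xs)
  case (Cons x xs)
  have "star A (eval_word A \<phi> (Word (x # xs))) =
      scale A (koszul (var_degree x) (word_degree (Word xs)))
        (mult A (star A (eval_word A \<phi> (Word xs))) (star A (\<phi> x)))"
    unfolding eval_word_simps by (rule star_mult[OF admissible_part eval_word_part])
  then show ?case
    by (simp add: Cons admissible_star mult_scale_left mult_scale_right eval_word_append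
        eval_word_simps mult_unit_right mult_ac)
qed (simp add: eval_word_simps star_unit)

lemma eval_star: "eval_poly A \<phi> (star_poly_star f) = star A (eval_poly A \<phi> f)"
proof (induction f rule: poly_induct)
  case (single w c)
  then show ?case
    by (cases w) (simp add: star_single eval_single star_scale star_eval_word mult.commute)
qed (simp_all add: star_zero star_zero' eval_zero star_add star_add' eval_add)

lemma eval_star_hom: "star_hom free_star_algebra A (eval_poly A \<phi>)"
  unfolding star_hom_free_iff
  by (intro conjI allI ballI vector_space_axioms eval_part eval_add eval_scale eval_mult eval_one
      eval_star)

end

section \<open>Universal property of the free algebra\<close>

lemma star_hom_eq_eval:
  assumes h: "star_hom free_star_algebra A h"
  shows "h f = eval_poly A (\<lambda>x. h (var_poly x)) f"
proof -
  have lin: "h (f + g) = h f + h g" "h (Poly_Mapping.single 0 c * f) = scale A c (h f)"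
    "h (f * g) = mult A (h f) (h g)" "h 1 = unit A" for f g c
    using h unfolding star_hom_free_iff by blast+
  have h0: "h 0 = 0" using lin(1)[of 0 0] by simp
  have hw: "h (Poly_Mapping.single (Word xs) 1) =
      eval_word A (\<lambda>x. h (var_poly x)) (Word xs)" for xs
  proof (induction xs)
    case Nil
    have "Poly_Mapping.single (Word []) (1::'k) = 1"
      by (simp flip: zero_word_def)
    then show ?case by (simp add: eval_word_simps lin)
  next
    case (Cons x xs)
    have "Poly_Mapping.single (Word (x # xs)) (1::'k) =
        var_poly x * Poly_Mapping.single (Word xs) 1"
      by (simp add: var_poly_def mult_single plus_word_def)
    then show ?case by (simp add: Cons lin eval_word_simps)
  qed
  show ?thesis
  proof (induction f rule: poly_induct)
    case (single w c)
    have "Poly_Mapping.single w c = Poly_Mapping.single 0 c * Poly_Mapping.single w 1"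
      by (simp add: mult_single)
    then show ?case
      using hw[of "letters w"] lin(2)[of c "Poly_Mapping.single w 1"] by (simp add: eval_single eval_scale)
  qed (simp_all add: h0 eval_zero eval_add lin)
qed

text \<open>Together with \<open>star_hom_eq_eval\<close> and \<open>eval_star_hom\<close>, this
  identifies the homomorphisms into \<open>A\<close> with the evaluations at admissible
  assignments.\<close>

lemma star_hom_admissible:
  assumes h: "star_hom free_star_algebra A h"
  shows "admissible A (\<lambda>x. h (var_poly x))"
proof -
  have parts: "var_poly (Y i j) \<in> symmetric_part (free_star_algebra :: ('k, _) salgebra) j"
    "var_poly (Z i j) \<in> skew_part (free_star_algebra :: ('k, _) salgebra) j" for i j
    by (rule var_poly_parts)+
  have "h (star_poly_star f) = star A (h f)" "f \<in> part free_star_algebra i \<Longrightarrow> h f \<in> part A i"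
    and "h (Poly_Mapping.single 0 (-1) * f) = scale A (-1) (h f)" for f i
    using h unfolding star_hom_free_iff by blast+
  moreover have "Poly_Mapping.single 0 (-1) * f = - f" for f :: "'k star_poly"
    by (simp add: single_uminus)
  ultimately show ?thesis
    using parts
    unfolding admissible_def symmetric_part_def skew_part_def free_sel(5)
    by (smt (verit) mem_Collect_eq scale_minus_left scale_one)
qed

text \<open>An endomorphism followed by an evaluation is a homomorphism into \<open>A\<close>, hence
  again an evaluation at an admissible assignment, where an identity vanishes.\<close>

theorem T2_ideal_star_identities: "T2_ideal (star_identities A)"
  unfolding T2_ideal_def two_sided_ideal_def
proof (intro conjI ballI allI impI subsetI)
  fix h g
  assume h: "star_hom free_star_algebra free_star_algebra h" and "g \<in> h ` star_identities A"
  then obtain f where f: "f \<in> star_identities A" "g = h f" by auto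
  have "eval_poly A \<phi> (h f) = 0" if \<phi>: "admissible A \<phi>" for \<phi>
  proof -
    have hom: "star_hom free_star_algebra A (eval_poly A \<phi> \<circ> h)"
      using h eval_star_hom[OF \<phi>] by (rule star_hom_comp)
    show ?thesis
      using f star_hom_admissible[OF hom] star_hom_eq_eval[OF hom, of f]
      by (auto simp: star_identities_def)
  qed
  then show "g \<in> star_identities A" by (simp add: star_identities_def f)
qed (auto simp: star_identities_def eval_zero eval_add eval_mult mult_zero)

end


section \<open>Generic matrices\<close>

text \<open>Dedekind's argument for the independence of characters applies, because a monomial
  function is multiplicative in \<open>t\<close>.\<close>

lemma monomials_independent:
  fixes a :: "'v multiset \<Rightarrow> 'k::field_char_0"
  assumes "finite S" and "\<And>t. (\<Sum>m\<in>S. a m * (\<Prod>x\<in>#m. t x)) = 0" and "m \<in> S"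
  shows "a m = 0"
  using assms
proof (induction S arbitrary: a m rule: finite_induct)
  case (insert n S)
  let ?\<chi> = "\<lambda>m t. \<Prod>x\<in>#m. (t x :: 'k)"
  have S: "a l = 0" if l: "l \<in> S" for l
  proof -
    have mult: "?\<chi> m (\<lambda>x. u x * t x) = ?\<chi> m u * ?\<chi> m t" for m :: "'v multiset" and u t
      by (induction m) simp_all
    \<comment> \<open>Subtracting \<open>?\<chi> n u\<close> times the relation at \<open>t\<close>
      from the relation at the pointwise product of \<open>u\<close> and \<open>t\<close> removes
      the term of \<open>n\<close>.\<close>
    have "(\<Sum>m\<in>S. (a m * (?\<chi> m u - ?\<chi> n u)) * ?\<chi> m t) = 0" for u t
    proof -
      have "(\<Sum>m\<in>S. (a m * (?\<chi> m u - ?\<chi> n u)) * ?\<chi> m t) =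
          (\<Sum>m\<in>insert n S. (a m * (?\<chi> m u - ?\<chi> n u)) * ?\<chi> m t)"
        using insert.hyps by simp
      also have "\<dots> = (\<Sum>m\<in>insert n S. a m * ?\<chi> m (\<lambda>x. u x * t x)) -
          ?\<chi> n u * (\<Sum>m\<in>insert n S. a m * ?\<chi> m t)"
        by (simp only: sum_distrib_left mult flip: sum_subtractf)
          (simp add: algebra_simps)
      finally show ?thesis using insert.prems(1)[of "\<lambda>x. u x * t x"] insert.prems(1)[of t] by simp
    qed
    from insert.IH[OF this l] have *: "a l * (?\<chi> l u - ?\<chi> n u) = 0" for u .
    have "l \<noteq> n" using l insert.hyps by auto
    then obtain x where x: "count l x \<noteq> count n x" by (auto simp: multiset_eq_iff)
    \<comment> \<open>This choice of \<open>u\<close> turns monomials into powers of two, which in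
      characteristic zero tell \<open>l\<close> and \<open>n\<close> apart by the multiplicity of
      \<open>x\<close>.\<close>
    have "?\<chi> m (\<lambda>y. if y = x then 2 else 1) = 2 ^ count m x" for m :: "'v multiset"
      by (induction m) simp_all
    moreover have "of_nat (2 ^ count l x) \<noteq> (of_nat (2 ^ count n x) :: 'k)"
      using x unfolding of_nat_eq_iff by simp
    ultimately show "a l = 0" using *[of "\<lambda>y. if y = x then 2 else 1"] by simp
  qed
  \<comment> \<open>At the constant assignment one every monomial is one, so only \<open>a n\<close>
    remains.\<close>
  moreover have "a n = 0"
    using insert.prems(1)[of "\<lambda>_. 1"] insert.hyps S by simp
  ultimately show ?case using insert.prems(2) by auto
qed simp

text \<open>Adjacent transpositions connect any two lists with the same multiset. \<open>R\<close>
  only has to respect prefixing, since the swap rule already has an arbitrary tail; \<open>S\<close>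
  keeps all letters in the class where swaps are available.\<close>

lemma mset_swap_induct [consumes 2, case_names refl trans Cons swap]:
  assumes "mset xs = mset ys" and "set xs \<subseteq> S"
    and refl: "\<And>xs. R xs xs"
    and trans: "\<And>xs ys zs. R xs ys \<Longrightarrow> R ys zs \<Longrightarrow> R xs zs"
    and Cons: "\<And>x xs ys. x \<in> S \<Longrightarrow> R xs ys \<Longrightarrow> R (x # xs) (x # ys)"
    and swap: "\<And>x y xs. x \<in> S \<Longrightarrow> y \<in> S \<Longrightarrow> R (x # y # xs) (y # x # xs)"
  shows "R xs ys"
  using assms(1,2)
proof (induction xs arbitrary: ys)
  case Nil
  then show ?case by (simp add: refl)
next
  case (Cons x xs)
  have "x \<in> set ys" using Cons.prems(1) by (metis list.set_intros(1) set_mset_mset)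
  then obtain as bs where ys: "ys = as @ x # bs" by (meson split_list)
  have S: "set ys \<subseteq> S" using Cons.prems by (metis set_mset_mset)
  \<comment> \<open>\<open>x\<close> travels to the right, letter by letter, to the place that it
    has in \<open>ys\<close>.\<close>
  have "R (x # cs @ bs) (cs @ x # bs)" if "set cs \<subseteq> S" for cs
    using that
  proof (induction cs)
    case Nil
    show ?case by (simp add: refl)
  next
    case (Cons c cs)
    then have "R (x # c # cs @ bs) (c # x # cs @ bs)"
      using \<open>x \<in> set ys\<close> S by (intro swap) auto
    moreover have "R (c # x # cs @ bs) (c # cs @ x # bs)"
      using Cons by (intro assms(5)) auto
    ultimately show ?case by (simp add: trans[of "x # c # cs @ bs"])
  qed
  moreover have "R (x # xs) (x # as @ bs)"
    using Cons.prems Cons.IH[of "as @ bs"] ys by (intro assms(5)) auto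
  ultimately show ?case
    using S ys trans[of "x # xs"] by auto
qed

text \<open>
  The action of a variable on the vector of row sums when the generic matrices
  \<open>t I\<close>, \<open>t (e\<^sub>1\<^sub>1 - e\<^sub>2\<^sub>2)\<close>, \<open>t e\<^sub>2\<^sub>1\<close>, \<open>t e\<^sub>1\<^sub>2\<close> are specialized to \<open>t = 1\<close>.
\<close>

fun letter_act :: "var \<Rightarrow> 'k::field \<times> 'k \<Rightarrow> 'k \<times> 'k" where
  "letter_act (Y i j) (a, b) = (if j = 0 then (a, b) else (0, a))"
| "letter_act (Z i j) (a, b) = (if j = 0 then (a, - b) else (b, 0))"

text \<open>The row sums of a product are the left factor applied to those of the right factor, so
  the fold starts at the row sums of the identity matrix.\<close>

definition row_sums :: "var list \<Rightarrow> 'k::field \<times> 'k" where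
  "row_sums xs = foldr letter_act xs (1, 1)"

lemma row_sums_simps [simp]:
  "row_sums [] = (1, 1)" "row_sums (x # xs) = letter_act x (row_sums xs)"
  by (simp_all add: row_sums_def)

text \<open>In characteristic zero each of the four symmetric or skew homogeneous parts of
  \<open>M11\<close> is a line, so one scalar per variable describes every admissible value.\<close>

fun generic :: "(var \<Rightarrow> 'k::field) \<Rightarrow> var \<Rightarrow> 'k^2^2" where
  "generic t (Y i j) = (if j = 0 then mat2 (t (Y i j)) 0 0 (t (Y i j)) else mat2 0 0 (t (Y i j)) 0)"
| "generic t (Z i j) = (if j = 0 then mat2 (t (Z i j)) 0 0 (- t (Z i j)) else mat2 0 (t (Z i j)) 0 0)"

lemma generic_admissible: "admissible (M11 :: ('k::field_char_0, 'k^2^2) salgebra) (generic t)"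
  unfolding admissible_def
proof (intro allI conjI)
  fix i j
  show "generic t (Y i j) \<in> symmetric_part (M11 :: ('k, 'k^2^2) salgebra) j"
    by (cases j rule: bit_cases) (auto simp: M11_parts)
  show "generic t (Z i j) \<in> skew_part (M11 :: ('k, 'k^2^2) salgebra) j"
    by (cases j rule: bit_cases) (auto simp: M11_parts)
qed

lemma generic_row_sums:
  fixes t :: "var \<Rightarrow> 'k::field"
  defines "W \<equiv> \<lambda>xs. eval_word M11 (generic t) (Word xs)"
  shows "W xs $ 1 $ 1 + W xs $ 1 $ 2 = (\<Prod>x\<in>#mset xs. t x) * fst (row_sums xs) \<and>
    W xs $ 2 $ 1 + W xs $ 2 $ 2 = (\<Prod>x\<in>#mset xs. t x) * snd (row_sums xs)"
proof (induction xs)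
  case Nil
  then show ?case
    by (simp add: W_def star_algebra.eval_word_simps[OF star_algebra_M11] M11_sel mat_def)
next
  case (Cons x xs)
  have W: "W (y # xs) = generic t y ** W xs" for y
    by (simp add: W_def star_algebra.eval_word_simps[OF star_algebra_M11] M11_sel)
  obtain a b :: 'k where ab: "row_sums xs = (a, b)" by fastforce
  let ?P = "\<Prod>x\<in>#mset xs. t x"
  \<comment> \<open>These are the forms in which the induction hypothesis enters the rows of
    \<open>generic t x ** W xs\<close>; the negated one serves even skew letters.\<close>
  have 1: "t x * W xs $ 1 $ 1 + t x * W xs $ 1 $ 2 = t x * (?P * a)"
    and 2: "t x * W xs $ 2 $ 1 + t x * W xs $ 2 $ 2 = t x * (?P * b)"
    using Cons by (simp_all add: ab flip: distrib_left)
  have 3: "- (t x * W xs $ 2 $ 1) - t x * W xs $ 2 $ 2 = - (t x * (?P * b))"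
    by (simp flip: 2)
  show ?case
    using 1 2 3 by (cases x) (auto simp: W ab matrix_mult_2 mult.assoc)
qed

text \<open>At generic matrices a row sum of the value of \<open>f\<close> is a combination of
  monomials in \<open>t\<close>, and the words contributing to a monomial are those with the
  corresponding multiset of letters. Independence of monomials kills each coefficient.\<close>

lemma star_identity_row_sums:
  fixes f :: "'k::field_char_0 star_poly"
  assumes f: "f \<in> star_identities M11"
  defines "C \<equiv> \<lambda>m. {w \<in> Poly_Mapping.keys f. mset (letters w) = m}"
  shows "(\<Sum>w\<in>C m. Poly_Mapping.lookup f w * fst (row_sums (letters w))) = 0"
    and "(\<Sum>w\<in>C m. Poly_Mapping.lookup f w * snd (row_sums (letters w))) = 0"
proof -
  let ?K = "Poly_Mapping.keys f" and ?c = "Poly_Mapping.lookup f"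
  let ?M = "(\<lambda>w. mset (letters w)) ` ?K"
  \<comment> \<open>\<open>p\<close> stands for either projection of the pair and \<open>i\<close>
    for the matching row, so one argument covers both.\<close>
  have zero: "(\<Sum>w\<in>C m. ?c w * p (row_sums (letters w))) = 0"
    if p: "\<And>t. \<exists>i. \<forall>xs. eval_word M11 (generic t) (Word xs) $ i $ 1 +
      eval_word M11 (generic t) (Word xs) $ i $ 2 = (\<Prod>x\<in>#mset xs. t x) * p (row_sums xs)"
    for p :: "'k \<times> 'k \<Rightarrow> 'k"
  proof (cases "m \<in> ?M")
    case True
    have "(\<Sum>m\<in>?M. (\<Sum>w\<in>C m. ?c w * p (row_sums (letters w))) * (\<Prod>x\<in>#m. t x)) = 0" for t
    proof -
      obtain i where i: "eval_word M11 (generic t) w $ i $ 1 +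
          eval_word M11 (generic t) w $ i $ 2 =
          (\<Prod>x\<in>#mset (letters w). t x) * p (row_sums (letters w))" for w
        using p[of t] by (metis word.collapse)
      have "(\<Sum>m\<in>?M. (\<Sum>w\<in>C m. ?c w * p (row_sums (letters w))) * (\<Prod>x\<in>#m. t x)) =
          (\<Sum>m\<in>?M. \<Sum>w\<in>C m. ?c w * (\<Prod>x\<in>#mset (letters w). t x) * p (row_sums (letters w)))"
        by (auto simp: C_def sum_distrib_left sum_distrib_right mult_ac intro!: sum.cong)
      also have "\<dots> = (\<Sum>w\<in>?K. ?c w * (\<Prod>x\<in>#mset (letters w). t x) * p (row_sums (letters w)))"
        unfolding C_def by (intro sum.image_gen[symmetric]) simp
      also have "\<dots> = (\<Sum>w\<in>?K. ?c w * (eval_word M11 (generic t) w $ i $ 1 +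
          eval_word M11 (generic t) w $ i $ 2))"
        by (simp add: i mult.assoc)
      also have "\<dots> = eval_poly M11 (generic t) f $ i $ 1 + eval_poly M11 (generic t) f $ i $ 2"
        by (simp add: eval_poly_def M11_sel sum.distrib distrib_left)
      also have "eval_poly M11 (generic t) f = 0"
        using f generic_admissible by (auto simp: star_identities_def)
      finally show ?thesis by simp
    qed
    from monomials_independent[OF _ this True] show ?thesis by simp
  next
    case False
    then have "C m = {}" by (auto simp: C_def)
    then show ?thesis by simp
  qed
  show "(\<Sum>w\<in>C m. ?c w * fst (row_sums (letters w))) = 0"
    using generic_row_sums by (intro zero) blast
  show "(\<Sum>w\<in>C m. ?c w * snd (row_sums (letters w))) = 0"
    using generic_row_sums by (intro zero) blast
qed


section \<open>Word polynomials\<close>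

interpretation free: star_algebra "free_star_algebra :: ('k::field, 'k star_poly) salgebra"
  by (rule star_algebra_free)

abbreviation const_poly :: "'k::field \<Rightarrow> 'k star_poly" where
  "const_poly c \<equiv> Poly_Mapping.single 0 c"

definition word_poly :: "var list \<Rightarrow> 'k::field star_poly" where
  "word_poly xs = prod_list (map var_poly xs)"

lemma word_poly_simps [simp]:
  "word_poly [] = 1" "word_poly (x # xs) = var_poly x * word_poly xs"
  by (simp_all add: word_poly_def)

lemma word_poly_eq_single: "word_poly xs = Poly_Mapping.single (Word xs) 1"
  by (induction xs) (simp_all add: var_poly_def mult_single plus_word_def flip: zero_word_def)

lemma const_poly_left_commute:
  "var_poly x * (const_poly c * g) = const_poly c * (var_poly x * g)"
  "word_poly xs * (const_poly c * g) = const_poly c * (word_poly xs * g)"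
  by (metis mult.assoc scalar_central)+

lemma const_poly_mult: "const_poly c * (const_poly d * f) = const_poly (c * d) * f"
  by (simp add: mult_single flip: mult.assoc)

text \<open>For an even letter this is both its effect on the second row sum and the sign picked up
  when an odd letter crosses it. Odd letters get the value one so that \<open>mset_sign\<close> can
  be taken over all letters of a word.\<close>

fun even_skew_sign :: "var \<Rightarrow> 'k::field" where
  "even_skew_sign (Y i j) = 1"
| "even_skew_sign (Z i j) = (if j = 0 then - 1 else 1)"

lemma even_skew_sign_square: "even_skew_sign x * even_skew_sign x = 1"
  by (cases x) simp_all

lemma even_skew_sign_cancel: "even_skew_sign x * (even_skew_sign x * c) = c"
  by (simp add: even_skew_sign_square flip: mult.assoc)

definition mset_sign :: "var multiset \<Rightarrow> 'k::field" where
  "mset_sign m = (\<Prod>x\<in>#m. even_skew_sign x)"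

lemma mset_sign_simps [simp]:
  "mset_sign {#} = 1" "mset_sign (add_mset x m) = even_skew_sign x * mset_sign m"
  by (simp_all add: mset_sign_def)

lemma mset_sign_square: "mset_sign m * mset_sign m = (1::'k::field)"
proof (induction m)
  case (add x m)
  have "mset_sign (add_mset x m) * mset_sign (add_mset x m) =
      ((even_skew_sign x * even_skew_sign x) * (mset_sign m * mset_sign m) :: 'k)"
    by (simp add: mult_ac)
  also have "\<dots> = 1" using add by (simp only: even_skew_sign_square mult_1)
  finally show ?case .
qed simp

definition odd_sym :: "var set" where "odd_sym = range (\<lambda>i. Y i 1)"
definition odd_skew :: "var set" where "odd_skew = range (\<lambda>i. Z i 1)"

lemma var_type_cases:
  obtains "var_degree x = 0" "x \<notin> odd_sym" "x \<notin> odd_skew"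
  | "x \<in> odd_sym" "x \<notin> odd_skew" "var_degree x = 1"
  | "x \<in> odd_skew" "x \<notin> odd_sym" "var_degree x = 1"
proof (cases x)
  case (Y i j)
  with that show ?thesis
    by (cases j rule: bit_cases) (auto simp: odd_sym_def odd_skew_def)
next
  case (Z i j)
  with that show ?thesis
    by (cases j rule: bit_cases) (auto simp: odd_sym_def odd_skew_def)
qed

lemma odd_parts: "x \<in> odd_sym \<Longrightarrow> var_degree x = 1" "x \<in> odd_skew \<Longrightarrow> var_degree x = 1"
  "x \<in> odd_sym \<Longrightarrow> x \<notin> odd_skew"
  by (auto simp: odd_sym_def odd_skew_def)

lemma letter_act_cases:
  "var_degree x = 0 \<Longrightarrow> letter_act x (a, b) = (a, even_skew_sign x * b)"
  "x \<in> odd_sym \<Longrightarrow> letter_act x (a, b) = (0, a)"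
  "x \<in> odd_skew \<Longrightarrow> letter_act x (a, b) = (b, 0)"
  by (cases x; auto simp: odd_sym_def odd_skew_def)+

lemma even_skew_sign_odd: "var_degree x = 1 \<Longrightarrow> even_skew_sign x = 1"
  by (cases x) simp_all

lemma admissible_var_poly: "admissible free_star_algebra var_poly"
  by (simp add: admissible_def var_poly_parts)

lemma admissible_upd:
  assumes "admissible free_star_algebra \<phi>"
  shows "s \<in> symmetric_part free_star_algebra j \<Longrightarrow> admissible free_star_algebra (\<phi>(Y i j := s))"
    and "s \<in> skew_part free_star_algebra j \<Longrightarrow> admissible free_star_algebra (\<phi>(Z i j := s))"
  using assms by (auto simp: admissible_def)

text \<open>Starring exchanges the two products: the Koszul sign of two odd factors cancels the sign
  of the skew letter.\<close>

lemma odd_anticommutator_symmetric: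
  "(yv i 1 * zv j 1 + zv j 1 * yv i 1 :: 'a::field star_poly) \<in> symmetric_part free_star_algebra 0"
proof -
  have eq: "yv i 1 * zv j 1 + zv j 1 * yv i 1 =
      (Poly_Mapping.single (Word [Y i 1, Z j 1]) 1 +
        Poly_Mapping.single (Word [Z j 1, Y i 1]) 1 :: 'a star_poly)"
    by (simp add: var_poly_def mult_single plus_word_def)
  show ?thesis
    unfolding eq using keys_add[of "Poly_Mapping.single (Word [Y i 1, Z j 1]) 1"
        "Poly_Mapping.single (Word [Z j 1, Y i 1]) (1::'a)"]
    by (auto simp: symmetric_part_def free_sel star_add star_single koszul_def word_degree_simps
        word_degree_def add.commute split: if_splits)
qed

section \<open>Congruences modulo the relations\<close>

text \<open>\<open>I\<close> is an arbitrary T-ideal containing the generators: their hull is the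
  intersection of all such ideals, so membership in each has to be shown.\<close>

locale M11_relations =
  fixes I :: "'k::field star_poly set"
  assumes T2: "T2_ideal I"
    and generators: "{commutator (yv 0 0) x | x. x \<in> {yv 1 0, yv 0 1, zv 0 0, zv 0 1}} \<union>
       {yv 0 1 * yv 1 1, zv 0 1 * zv 1 1, commutator (zv 0 0) (zv 1 0),
        anticommutator (zv 0 0) (zv 0 1), anticommutator (zv 0 0) (yv 0 1)} \<subseteq> I"
begin

lemma ideal_simps:
  "0 \<in> I" "f \<in> I \<Longrightarrow> g \<in> I \<Longrightarrow> f + g \<in> I" "f \<in> I \<Longrightarrow> g * f \<in> I" "f \<in> I \<Longrightarrow> f * g \<in> I"
  using T2 by (auto simp: T2_ideal_def two_sided_ideal_def)

lemma ideal_uminus: "f \<in> I \<Longrightarrow> - f \<in> I"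
  using ideal_simps(3)[of f "- 1"] by simp

definition cong :: "'k star_poly \<Rightarrow> 'k star_poly \<Rightarrow> bool" (infix "\<approx>" 50) where
  "f \<approx> g \<longleftrightarrow> f - g \<in> I"

lemma cong_refl [simp]: "f \<approx> f"
  by (simp add: cong_def ideal_simps)

lemma cong_sym: "f \<approx> g \<Longrightarrow> g \<approx> f"
  using ideal_uminus[of "f - g"] by (simp add: cong_def)

lemma cong_trans [trans]: "f \<approx> g \<Longrightarrow> g \<approx> h \<Longrightarrow> f \<approx> h"
  using ideal_simps(2)[of "f - g" "g - h"] by (simp add: cong_def)

lemma cong_add: "f \<approx> g \<Longrightarrow> f' \<approx> g' \<Longrightarrow> f + f' \<approx> g + g'"
  using ideal_simps(2)[of "f - g" "f' - g'"] by (simp add: cong_def algebra_simps)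

lemma cong_mult: "f \<approx> g \<Longrightarrow> f' \<approx> g' \<Longrightarrow> f * f' \<approx> g * g'"
  using ideal_simps(2)[OF ideal_simps(4)[of "f - g" f'] ideal_simps(3)[of "f' - g'" g]]
  by (simp add: cong_def algebra_simps)

lemma cong_mult_left: "f \<approx> g \<Longrightarrow> h * f \<approx> h * g"
  by (simp add: cong_mult)

lemma cong_mult_right: "f \<approx> g \<Longrightarrow> f * h \<approx> g * h"
  by (simp add: cong_mult)

lemma cong_zero_left: "f \<approx> 0 \<Longrightarrow> h * f \<approx> 0"
  using cong_mult_left[of f 0 h] by simp

lemma cong_zero_right: "f \<approx> 0 \<Longrightarrow> f * h \<approx> 0"
  using cong_mult_right[of f 0 h] by simp

lemma cong_sum: "(\<And>x. x \<in> S \<Longrightarrow> f x \<approx> g x) \<Longrightarrow> sum f S \<approx> sum g S"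
  by (induction S rule: infinite_finite_induct) (simp_all add: cong_add)

text \<open>An evaluation in the free algebra at an admissible assignment is a graded endomorphism
  commuting with the superinvolution.\<close>

lemma substitution: "admissible free_star_algebra \<phi> \<Longrightarrow> f \<in> I \<Longrightarrow> eval_poly free_star_algebra \<phi> f \<in> I"
  using T2 free.eval_star_hom unfolding T2_ideal_def by blast

lemmas eval_rules =
  free.eval_add free.eval_diff free.eval_mult free.eval_var free_sel

text \<open>Substitution can replace \<open>yv 0 0\<close> by any symmetric even element, not merely
  a variable, and the four commutators with it cover the four kinds of letters. This generality
  later makes odd anticommutators central.\<close>

lemma symmetric_even_central:
  assumes s: "s \<in> symmetric_part free_star_algebra 0"
  shows "s * var_poly x \<approx> var_poly x * s"
proof -
  \<comment> \<open>The assignments supplied by \<open>\<phi>\<close> send \<open>Y 0 0\<close> to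
    \<open>s\<close> and the partner variable of the commutator to \<open>x\<close>.\<close>
  note admissible_upd(1)[OF admissible_var_poly s, where i = 0]
  note \<phi> = admissible_upd(1)[OF this var_poly_parts(1)] admissible_upd(2)[OF this var_poly_parts(2)]
  have g: "commutator (yv 0 0) v \<in> I" if "v \<in> {yv 1 0, yv 0 1, zv 0 0, zv 0 1}" for v
    using that generators by auto
  show ?thesis
  proof (cases x)
    case (Y i j)
    then show ?thesis
      using substitution[OF \<phi>(1)[of 1 0 i] g[of "yv 1 0"]] substitution[OF \<phi>(1)[of 0 1 i] g[of "yv 0 1"]]
      by (cases j rule: bit_cases) (simp_all add: commutator_def eval_rules cong_def)
  next
    case (Z i j)
    then show ?thesis
      using substitution[OF \<phi>(2)[of 0 0 i] g[of "zv 0 0"]] substitution[OF \<phi>(2)[of 0 1 i] g[of "zv 0 1"]]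
      by (cases j rule: bit_cases) (simp_all add: commutator_def eval_rules cong_def)
  qed
qed

lemma odd_sym_product: "x \<in> odd_sym \<Longrightarrow> y \<in> odd_sym \<Longrightarrow> var_poly x * var_poly y \<approx> 0"
  using substitution[OF admissible_upd(1)[OF admissible_upd(1)[OF admissible_var_poly
      var_poly_parts(1)] var_poly_parts(1)], of "yv 0 1 * yv 1 1" 0 1 _ 1 1] generators
  by (auto simp: odd_sym_def eval_rules cong_def)

lemma odd_skew_product: "x \<in> odd_skew \<Longrightarrow> y \<in> odd_skew \<Longrightarrow> var_poly x * var_poly y \<approx> 0"
  using substitution[OF admissible_upd(2)[OF admissible_upd(2)[OF admissible_var_poly
      var_poly_parts(2)] var_poly_parts(2)], of "zv 0 1 * zv 1 1" 0 1 _ 1 1] generators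
  by (auto simp: odd_skew_def eval_rules cong_def)

lemma even_commute:
  assumes "var_degree x = 0" "var_degree y = 0"
  shows "var_poly x * var_poly y \<approx> var_poly y * var_poly x"
proof -
  have Z: "zv i 0 * zv j 0 \<approx> zv j 0 * zv i 0" for i j
    using substitution[OF admissible_upd(2)[OF admissible_upd(2)[OF admissible_var_poly
        var_poly_parts(2)] var_poly_parts(2)], of "commutator (zv 0 0) (zv 1 0)" 0 0 i 1 0 j] generators
    by (auto simp: commutator_def eval_rules cong_def)
  note central = symmetric_even_central[OF var_poly_parts(1)]
  show ?thesis
    using assms by (cases x; cases y) (simp_all add: central cong_sym[OF central] Z)
qed

lemma odd_even_commute:
  assumes "var_degree x = 1" "var_degree e = 0"
  shows "var_poly x * var_poly e \<approx> const_poly (even_skew_sign e) * (var_poly e * var_poly x)"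
proof -
  \<comment> \<open>Only a skew even letter costs a sign, through the two anticommutator generators;
    a symmetric one is central.\<close>
  have "var_poly x * zv i 0 \<approx> - (zv i 0 * var_poly x)" if e: "e = Z i 0" for i
  proof (cases x)
    case (Y j l)
    then show ?thesis
      using assms(1) substitution[OF admissible_upd(1)[OF admissible_upd(2)[OF admissible_var_poly
        var_poly_parts(2)] var_poly_parts(1)], of "anticommutator (zv 0 0) (yv 0 1)" 0 0 i 0 1 j]
        generators
      by (auto simp: anticommutator_def eval_rules cong_def add.commute)
  next
    case (Z j l)
    then show ?thesis
      using assms(1) substitution[OF admissible_upd(2)[OF admissible_upd(2)[OF admissible_var_poly
        var_poly_parts(2)] var_poly_parts(2)], of "anticommutator (zv 0 0) (zv 0 1)" 0 0 i 0 1 j]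
        generators
      by (auto simp: anticommutator_def eval_rules cong_def add.commute)
  qed
  then show ?thesis
    using assms cong_sym[OF symmetric_even_central[OF var_poly_parts(1)]]
    by (cases e) (simp_all add: single_uminus)
qed

text \<open>
  Since \<open>y z + z y\<close> is symmetric of degree \<open>0\<close>, it is central modulo \<open>I\<close>, whence
  \<open>y z y' \<approx> (y z + z y) y' \<approx> y' (y z + z y) \<approx> y' z y\<close>.
\<close>

lemma odd_sym_swap:
  assumes "x \<in> odd_sym" "y \<in> odd_sym" "z \<in> odd_skew"
  shows "var_poly x * (var_poly z * var_poly y) \<approx> var_poly y * (var_poly z * var_poly x)"
proof -
  let ?x = "var_poly x" and ?y = "var_poly y" and ?z = "var_poly z"
  have "(?x * ?z + ?z * ?x) * ?y \<approx> ?y * (?x * ?z + ?z * ?x)"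
    using assms odd_anticommutator_symmetric
    by (intro symmetric_even_central) (auto simp: odd_sym_def odd_skew_def)
  moreover have "?z * (?x * ?y) \<approx> 0" "?y * ?x * ?z \<approx> 0"
    using assms by (simp_all add: cong_zero_left cong_zero_right odd_sym_product)
  ultimately have "(?x * ?z + ?z * ?x) * ?y - ?y * (?x * ?z + ?z * ?x)
      + (- (?z * (?x * ?y))) + ?y * ?x * ?z \<in> I"
    by (intro ideal_simps(2) ideal_uminus) (simp_all add: cong_def)
  then show ?thesis by (simp add: cong_def algebra_simps)
qed

text \<open>The same anticommutator is central; now it is the products of two skew odd letters that
  vanish.\<close>

lemma odd_skew_swap:
  assumes "x \<in> odd_skew" "y \<in> odd_skew" "z \<in> odd_sym"
  shows "var_poly x * (var_poly z * var_poly y) \<approx> var_poly y * (var_poly z * var_poly x)"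
proof -
  let ?x = "var_poly x" and ?y = "var_poly y" and ?z = "var_poly z"
  have "(?z * ?x + ?x * ?z) * ?y \<approx> ?y * (?z * ?x + ?x * ?z)"
    using assms odd_anticommutator_symmetric
    by (intro symmetric_even_central) (auto simp: odd_sym_def odd_skew_def)
  moreover have "?z * (?x * ?y) \<approx> 0" "?y * ?x * ?z \<approx> 0"
    using assms by (simp_all add: cong_zero_left cong_zero_right odd_skew_product)
  ultimately have "(?z * ?x + ?x * ?z) * ?y - ?y * (?z * ?x + ?x * ?z)
      + (- (?z * (?x * ?y))) + ?y * ?x * ?z \<in> I"
    by (intro ideal_simps(2) ideal_uminus) (simp_all add: cong_def)
  then show ?thesis by (simp add: cong_def algebra_simps)
qed


section \<open>Rearranging the letters of a word modulo the relations\<close>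

lemma word_poly_even_perm:
  assumes "mset xs = mset ys" "set xs \<subseteq> {x. var_degree x = 0}"
  shows "word_poly xs \<approx> word_poly ys"
  using assms
proof (induction rule: mset_swap_induct)
  case (trans xs ys zs)
  then show ?case by (rule cong_trans)
next
  case (Cons x xs ys)
  then show ?case by (simp add: cong_mult_left)
next
  case (swap x y xs)
  then show ?case
    using cong_mult_right[OF even_commute] by (simp flip: mult.assoc)
qed simp

lemma odd_past_evens:
  assumes "var_degree x = 1" "set es \<subseteq> {x. var_degree x = 0}"
  shows "var_poly x * word_poly es \<approx>
    const_poly (mset_sign (mset es)) * (word_poly es * var_poly x)"
  using assms(2)
proof (induction es)
  case (Cons e es)
  let ?c = "const_poly (even_skew_sign e)" and ?d = "const_poly (mset_sign (mset es))"
  have "var_poly x * var_poly e * word_poly es \<approx> ?c * (var_poly e * var_poly x) * word_poly es"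
    using Cons.prems assms(1) by (intro cong_mult_right odd_even_commute) auto
  also have "\<dots> = ?c * var_poly e * (var_poly x * word_poly es)"
    by (simp add: mult.assoc)
  also have "\<dots> \<approx> ?c * var_poly e * (?d * (word_poly es * var_poly x))"
    using Cons by (intro cong_mult_left) auto
  finally show ?case
    by (simp add: mult.assoc const_poly_left_commute const_poly_mult)
qed simp

text \<open>Both orders of interleaving are treated at once, and for all \<open>zs\<close>, because
  removing the head of a \<open>splice\<close> exchanges the roles of its two arguments. The sets
  \<open>A\<close> and \<open>B\<close> stand for the two types of odd letters, in either
  order.\<close>

lemma splice_perm:
  assumes zero: "\<And>x y. x \<in> A \<Longrightarrow> y \<in> A \<Longrightarrow> var_poly x * var_poly y \<approx> 0"
    and swap: "\<And>x y z. x \<in> A \<Longrightarrow> y \<in> A \<Longrightarrow> z \<in> B \<Longrightarrow>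
      var_poly x * (var_poly z * var_poly y) \<approx> var_poly y * (var_poly z * var_poly x)"
    and "mset xs = mset ys" "set xs \<subseteq> A" "set zs \<subseteq> B"
  shows "word_poly (splice xs zs) \<approx> word_poly (splice ys zs) \<and>
    word_poly (splice zs xs) \<approx> word_poly (splice zs ys)"
  using assms(3-5)
proof (induction arbitrary: zs rule: mset_swap_induct)
  case (trans xs ys us)
  from trans.IH[OF trans.prems] show ?case
    by (elim conjE) (rule conjI; erule (1) cong_trans)
next
  case (Cons x xs ys)
  have "word_poly xs \<approx> word_poly ys"
    using Cons.IH[of "[]"] by simp
  moreover have "word_poly (splice xs zs) \<approx> word_poly (splice ys zs)"
    "word_poly (splice zs xs) \<approx> word_poly (splice zs ys)" if "set zs \<subseteq> B" for zs
    using Cons.IH that by auto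
  ultimately show ?case
    using Cons.prems by (cases zs) (simp_all add: cong_mult_left)
next
  case (swap x y xs)
  \<comment> \<open>Once \<open>zs\<close> is exhausted, \<open>x\<close> and \<open>y\<close> are
    adjacent and both orders vanish; otherwise a letter of \<open>zs\<close> separates them and
    \<open>three\<close> applies.\<close>
  have two: "var_poly x * (var_poly y * f) \<approx> var_poly y * (var_poly x * f)" for f
  proof -
    have "var_poly x * (var_poly y * f) \<approx> 0" "var_poly y * (var_poly x * f) \<approx> 0"
      using cong_zero_right[OF zero] swap by (simp_all flip: mult.assoc)
    then show ?thesis by (rule cong_trans[OF _ cong_sym])
  qed
  have three: "var_poly x * (var_poly z * (var_poly y * f)) \<approx>
      var_poly y * (var_poly z * (var_poly x * f))" if "z \<in> B" for z f
    using cong_mult_right[OF assms(2)[OF swap(1,2) that], of f] by (simp add: mult.assoc)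
  show ?case
  proof (cases zs)
    case Nil
    then show ?thesis by (simp add: two)
  next
    case (Cons z zs')
    then have "set (z # zs') \<subseteq> B" using swap by simp
    then show ?thesis
      by (cases zs') (simp_all add: Cons two three cong_mult_left)
  qed
qed simp


lemma word_poly_same_type:
  assumes zero: "\<And>x y. x \<in> A \<Longrightarrow> y \<in> A \<Longrightarrow> var_poly x * var_poly y \<approx> 0"
    and "x \<in> A" "y \<in> A"
  shows "var_poly x * (var_poly y * f) \<approx> 0"
  using cong_zero_right[OF zero[OF assms(2,3)]] by (simp add: mult.assoc)

end

section \<open>Normal forms of words\<close>

text \<open>An arbitrary listing stands in for a sorted one; the permutation lemmas absorb the
  choice.\<close>

definition arrange :: "'a multiset \<Rightarrow> 'a list" where
  "arrange m = (SOME xs. mset xs = m)"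

lemma mset_arrange [simp]: "mset (arrange m) = m"
  unfolding arrange_def by (rule someI_ex) (rule ex_mset)

lemma set_arrange [simp]: "set (arrange m) = set_mset m"
  by (metis mset_arrange set_mset_mset)

lemma arrange_empty [simp]: "arrange {#} = []"
  by (metis mset_arrange mset_zero_iff)

lemma arrange_Cons: "arrange m = x # xs \<Longrightarrow> x \<in># m"
  by (metis list.set_intros(1) set_arrange)

lemma arrange_nonempty: "m \<noteq> {#} \<Longrightarrow> \<exists>x xs. arrange m = x # xs"
  by (metis list.exhaust mset.simps(1) mset_arrange)

lemma arrange_single [simp]: "arrange {#x#} = [x]"
  by (metis mset_arrange mset_single_iff)

definition evens :: "var multiset \<Rightarrow> var multiset" where
  "evens m = filter_mset (\<lambda>x. var_degree x = 0) m"

definition syms :: "var multiset \<Rightarrow> var multiset" where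
  "syms m = filter_mset (\<lambda>x. x \<in> odd_sym) m"

definition skews :: "var multiset \<Rightarrow> var multiset" where
  "skews m = filter_mset (\<lambda>x. x \<in> odd_skew) m"

lemma parts_simps [simp]:
  "evens {#} = {#}" "syms {#} = {#}" "skews {#} = {#}"
  "evens (add_mset x m) = (if var_degree x = 0 then add_mset x (evens m) else evens m)"
  "syms (add_mset x m) = (if x \<in> odd_sym then add_mset x (syms m) else syms m)"
  "skews (add_mset x m) = (if x \<in> odd_skew then add_mset x (skews m) else skews m)"
  by (simp_all add: evens_def syms_def skews_def)

lemma set_parts:
  "set_mset (evens m) \<subseteq> {x. var_degree x = 0}"
  "set_mset (syms m) \<subseteq> odd_sym" "set_mset (skews m) \<subseteq> odd_skew"
  by (auto simp: evens_def syms_def skews_def)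

definition even_word :: "var multiset \<Rightarrow> 'k::field star_poly" where
  "even_word m = word_poly (arrange (evens m))"

definition skew_first :: "var multiset \<Rightarrow> 'k::field star_poly" where
  "skew_first m = (if skews m = {#} then 0 else
     even_word m * word_poly (splice (arrange (skews m)) (arrange (syms m))))"

definition sym_first :: "var multiset \<Rightarrow> 'k::field star_poly" where
  "sym_first m = (if syms m = {#} then 0 else const_poly (mset_sign m) *
     (even_word m * word_poly (splice (arrange (syms m)) (arrange (skews m)))))"

text \<open>
  The matrix of a word with an odd letter is a multiple of a matrix unit, so the row sums determine
  it; the sign in \<^const>\<open>sym_first\<close> is the second diagonal entry of the product of the even
  letters.  The zero cases are needed when there are odd letters of one type only: for a single one
  the two interleavings coincide.
\<close>

definition normal_form :: "var multiset \<Rightarrow> 'k::field \<times> 'k \<Rightarrow> 'k star_poly" where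
  "normal_form m p = (if \<forall>x\<in>#m. var_degree x = 0 then const_poly (fst p) * even_word m
     else const_poly (fst p) * skew_first m + const_poly (snd p) * sym_first m)"

lemma normal_form_mixed:
  "\<not> (\<forall>x\<in>#m. var_degree x = 0) \<Longrightarrow> normal_form m (a, b) =
    const_poly a * skew_first m + const_poly b * sym_first m"
  unfolding normal_form_def by (simp only: if_False fst_conv snd_conv)

lemma normal_form_zero: "normal_form m (0, 0) = 0"
  by (simp add: normal_form_def)

lemma mset_sign_evens: "mset_sign (evens m) = mset_sign m"
  by (induction m) (auto simp: even_skew_sign_odd)

lemma only_evens:
  assumes "\<forall>x\<in>#m. var_degree x = 0"
  shows "syms m = {#}" "skews m = {#}"
  using assms by (auto simp: syms_def skews_def dest: odd_parts)

lemma not_only_evens: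
  assumes "\<not> (\<forall>x\<in>#m. var_degree x = 0)"
  shows "syms m \<noteq> {#} \<or> skews m \<noteq> {#}"
proof -
  obtain x where "x \<in># m" "var_degree x \<noteq> 0" using assms by blast
  then show ?thesis by (cases x rule: var_type_cases) (auto simp: syms_def skews_def)
qed

text \<open>For purely even words the second row sum is determined by the letters, which is why
  \<open>normal_form\<close> can keep only the first coefficient there.\<close>

lemma row_sums_even:
  "set xs \<subseteq> {x. var_degree x = 0} \<Longrightarrow>
    row_sums xs = (1, mset_sign (mset xs))"
  by (induction xs) (simp_all add: letter_act_cases)

section \<open>Prefixing a letter to a normal form\<close>

context M11_relations
begin

lemma even_word_add_even:
  assumes "var_degree x = 0"
  shows "var_poly x * even_word m \<approx> even_word (add_mset x m)"
proof -
  have "word_poly (x # arrange (evens m)) \<approx> word_poly (arrange (evens (add_mset x m)))"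
    using assms set_parts by (intro word_poly_even_perm) auto
  then show ?thesis using assms by (simp add: even_word_def)
qed

lemma even_word_add_odd: "var_degree x = 1 \<Longrightarrow> even_word (add_mset x m) = even_word m"
  by (simp add: even_word_def)

lemma odd_past_even_word:
  assumes "var_degree x = 1"
  shows "var_poly x * (even_word m * f) \<approx> const_poly (mset_sign m) * (even_word m * (var_poly x * f))"
  using cong_mult_right[OF odd_past_evens[OF assms, of "arrange (evens m)"], of f] set_parts(1)
  by (simp add: even_word_def mset_sign_evens mult.assoc)

lemma splice_perm_syms:
  assumes "mset xs = mset ys" "set xs \<subseteq> odd_sym" "set zs \<subseteq> odd_skew"
  shows "word_poly (splice xs zs) \<approx> word_poly (splice ys zs)"
  using splice_perm[OF odd_sym_product odd_sym_swap assms] by simp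

lemma splice_perm_skews:
  assumes "mset xs = mset ys" "set xs \<subseteq> odd_skew" "set zs \<subseteq> odd_sym"
  shows "word_poly (splice xs zs) \<approx> word_poly (splice ys zs)"
  using splice_perm[OF odd_skew_product odd_skew_swap assms] by simp

text \<open>Crossing the even letters produces exactly the sign built into \<open>sym_first\<close>,
  and \<open>x\<close> then opens an alternation that starts with a symmetric letter.\<close>

lemma sym_times_skew_first:
  assumes x: "x \<in> odd_sym" and m: "\<not> (\<forall>x\<in>#m. var_degree x = 0)"
  shows "var_poly x * skew_first m \<approx> sym_first (add_mset x m)"
proof -
  have d: "var_degree x = 1" "x \<notin> odd_skew" using odd_parts x by auto
  have perm: "var_poly x * word_poly (splice (arrange (skews m)) (arrange (syms m))) \<approx>
      word_poly (splice (arrange (syms (add_mset x m))) (arrange (skews m)))"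
    using splice_perm_syms[of "x # arrange (syms m)" "arrange (syms (add_mset x m))"
        "arrange (skews m)"] x set_parts by auto
  have s: "sym_first (add_mset x m) = const_poly (mset_sign m) * (even_word m *
      word_poly (splice (arrange (syms (add_mset x m))) (arrange (skews m))))"
    using x d by (simp add: sym_first_def even_word_add_odd even_skew_sign_odd del: arrange_single)
  show ?thesis
  proof (cases "skews m = {#}")
    \<comment> \<open>Without skew odd letters the left side is zero by definition, and on the right
      two symmetric odd letters become adjacent.\<close>
    case True
    then have "syms m \<noteq> {#}" using not_only_evens[OF m] by simp
    then obtain y ys where ys: "arrange (syms m) = y # ys"
      using arrange_nonempty by blast
    then have "y \<in> odd_sym" using arrange_Cons[OF ys] set_parts(2)[of m] by auto
    then have "var_poly x * word_poly (arrange (syms m)) \<approx> 0"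
      using word_poly_same_type[OF odd_sym_product x] by (simp add: ys)
    then have "sym_first (add_mset x m) \<approx> 0"
      unfolding s using cong_trans[OF cong_sym[OF perm]] True by (simp add: cong_zero_left)
    then show ?thesis using True by (simp add: skew_first_def cong_sym)
  next
    case False
    then have "var_poly x * skew_first m \<approx> const_poly (mset_sign m) * (even_word m *
        (var_poly x * word_poly (splice (arrange (skews m)) (arrange (syms m)))))"
      using odd_past_even_word d by (simp add: skew_first_def)
    also have "\<dots> \<approx> sym_first (add_mset x m)"
      unfolding s by (intro cong_mult_left perm)
    finally show ?thesis .
  qed
qed

text \<open>The sign from crossing the even letters meets the one inside \<open>sym_first\<close>,
  and their product is one.\<close>

lemma skew_times_sym_first:
  assumes x: "x \<in> odd_skew" and m: "\<not> (\<forall>x\<in>#m. var_degree x = 0)"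
  shows "var_poly x * sym_first m \<approx> skew_first (add_mset x m)"
proof -
  have d: "var_degree x = 1" "x \<notin> odd_sym" using odd_parts x by auto
  have perm: "var_poly x * word_poly (splice (arrange (syms m)) (arrange (skews m))) \<approx>
      word_poly (splice (arrange (skews (add_mset x m))) (arrange (syms m)))"
    using splice_perm_skews[of "x # arrange (skews m)" "arrange (skews (add_mset x m))"
        "arrange (syms m)"] x set_parts by auto
  have s: "skew_first (add_mset x m) = even_word m *
      word_poly (splice (arrange (skews (add_mset x m))) (arrange (syms m)))"
    using x d by (simp add: skew_first_def even_word_add_odd)
  show ?thesis
  proof (cases "syms m = {#}")
    case True
    then have "skews m \<noteq> {#}" using not_only_evens[OF m] by simp
    then obtain y ys where ys: "arrange (skews m) = y # ys"
      using arrange_nonempty by blast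
    then have "y \<in> odd_skew" using arrange_Cons[OF ys] set_parts(3)[of m] by auto
    then have "var_poly x * word_poly (arrange (skews m)) \<approx> 0"
      using word_poly_same_type[OF odd_skew_product x] by (simp add: ys)
    then have "skew_first (add_mset x m) \<approx> 0"
      unfolding s using cong_trans[OF cong_sym[OF perm]] True by (simp add: cong_zero_left)
    then show ?thesis using True by (simp add: sym_first_def cong_sym)
  next
    case False
    let ?w = "word_poly (splice (arrange (syms m)) (arrange (skews m)))"
    have "var_poly x * sym_first m =
        const_poly (mset_sign m) * (var_poly x * (even_word m * ?w))"
      using False by (simp add: sym_first_def const_poly_left_commute)
    also have "\<dots> \<approx> const_poly (mset_sign m) *
        (const_poly (mset_sign m) * (even_word m * (var_poly x * ?w)))"
      by (intro cong_mult_left odd_past_even_word d)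
    also have "\<dots> = even_word m * (var_poly x * ?w)"
      by (simp add: const_poly_mult mset_sign_square)
    also have "\<dots> \<approx> skew_first (add_mset x m)"
      unfolding s by (intro cong_mult_left perm)
    finally show ?thesis .
  qed
qed

text \<open>After crossing the even letters, \<open>x\<close> meets the leading symmetric odd letter
  of the alternating word.\<close>

lemma sym_times_sym_first:
  assumes x: "x \<in> odd_sym"
  shows "var_poly x * sym_first m \<approx> 0"
proof (cases "arrange (syms m)")
  case Nil
  then have "syms m = {#}" by (metis mset.simps(1) mset_arrange)
  then show ?thesis by (simp add: sym_first_def)
next
  case (Cons y ys)
  have y: "y \<in> odd_sym" using arrange_Cons[OF Cons] set_parts(2)[of m] by auto
  have ne: "syms m \<noteq> {#}" using Cons by auto
  let ?w = "word_poly (splice (arrange (syms m)) (arrange (skews m)))"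
  have "var_poly x * (even_word m * ?w) \<approx> const_poly (mset_sign m) * (even_word m * (var_poly x * ?w))"
    using x by (simp add: odd_past_even_word odd_parts)
  also have "\<dots> \<approx> 0"
    unfolding Cons splice.simps word_poly_simps
    by (intro cong_zero_left word_poly_same_type[OF odd_sym_product x y])
  finally show ?thesis
    using ne by (simp add: sym_first_def const_poly_left_commute cong_zero_left)
qed

lemma skew_times_skew_first:
  assumes x: "x \<in> odd_skew"
  shows "var_poly x * skew_first m \<approx> 0"
proof (cases "arrange (skews m)")
  case Nil
  then have "skews m = {#}" by (metis mset.simps(1) mset_arrange)
  then show ?thesis by (simp add: skew_first_def)
next
  case (Cons y ys)
  have y: "y \<in> odd_skew" using arrange_Cons[OF Cons] set_parts(3)[of m] by auto
  have ne: "skews m \<noteq> {#}" using Cons by auto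
  let ?w = "word_poly (splice (arrange (skews m)) (arrange (syms m)))"
  have "var_poly x * (even_word m * ?w) \<approx> const_poly (mset_sign m) * (even_word m * (var_poly x * ?w))"
    using x by (simp add: odd_past_even_word odd_parts)
  also have "\<dots> \<approx> 0"
    unfolding Cons splice.simps word_poly_simps
    by (intro cong_zero_left word_poly_same_type[OF odd_skew_product x y])
  finally show ?thesis
    using ne by (simp add: skew_first_def)
qed

text \<open>The four products computed above describe how \<open>x\<close> acts on
  \<open>skew_first\<close> and \<open>sym_first\<close>; on coefficients this is
  \<open>letter_act\<close>.\<close>

lemma normal_form_add_odd_mixed:
  assumes "var_degree x = 1" and m: "\<not> (\<forall>y\<in>#m. var_degree y = 0)"
  shows "var_poly x * normal_form m (a, b) \<approx> normal_form (add_mset x m) (letter_act x (a, b))"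
proof -
  have l: "var_poly x * normal_form m (a, b) =
      const_poly a * (var_poly x * skew_first m) + const_poly b * (var_poly x * sym_first m)"
    by (simp add: normal_form_mixed[OF m] distrib_left const_poly_left_commute)
  have m': "\<not> (\<forall>y\<in>#add_mset x m. var_degree y = 0)" using m by auto
  show ?thesis
  proof (cases x rule: var_type_cases)
    case 2
    have "var_poly x * normal_form m (a, b) \<approx> const_poly a * sym_first (add_mset x m) + const_poly b * 0"
      unfolding l using 2 m
      by (intro cong_add cong_mult_left sym_times_skew_first sym_times_sym_first) auto
    then show ?thesis using 2 by (simp add: normal_form_mixed[OF m'] letter_act_cases)
  next
    case 3
    have "var_poly x * normal_form m (a, b) \<approx> const_poly a * 0 + const_poly b * skew_first (add_mset x m)"
      unfolding l using 3 m
      by (intro cong_add cong_mult_left skew_times_sym_first skew_times_skew_first) auto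
    then show ?thesis using 3 by (simp add: normal_form_mixed[OF m'] letter_act_cases)
  qed (use assms in simp)
qed

text \<open>The pair is that of an actual even word: for a skew \<open>x\<close> the new coefficient
  is the second entry of the pair, whereas \<open>normal_form m\<close> records only the first, so
  the two must be linked by \<open>mset_sign m\<close>.\<close>

lemma normal_form_add_odd_only_evens:
  assumes x: "var_degree x = 1" and m: "\<forall>y\<in>#m. var_degree y = 0"
  shows "var_poly x * normal_form m (1, mset_sign m) \<approx>
    normal_form (add_mset x m) (letter_act x (1, mset_sign m))"
proof -
  have "var_poly x * normal_form m (1, mset_sign m) \<approx>
      const_poly (mset_sign m) * (even_word m * var_poly x)"
    using m odd_past_even_word[OF x, of m 1] by (simp add: normal_form_def)
  also have "\<dots> = normal_form (add_mset x m) (letter_act x (1, mset_sign m))"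
    by (cases x rule: var_type_cases)
      (use x m only_evens[OF m] in \<open>simp_all add: normal_form_def letter_act_cases skew_first_def
        sym_first_def even_word_add_odd even_skew_sign_odd\<close>)
  finally show ?thesis .
qed

text \<open>An even letter joins the even prefix and changes only the sign built into
  \<open>sym_first\<close>, which matches its action on the second row sum.\<close>

lemma normal_form_add_even:
  assumes x: "var_degree x = 0"
  shows "var_poly x * normal_form m (a, b) \<approx> normal_form (add_mset x m) (letter_act x (a, b))"
proof (cases "\<forall>y\<in>#m. var_degree y = 0")
  case True
  then show ?thesis
    using x even_word_add_even[OF x]
    by (simp add: normal_form_def letter_act_cases const_poly_left_commute cong_mult_left)
next
  case False
  note odd = var_type_cases[of x "x \<notin> odd_sym \<and> x \<notin> odd_skew"]
  have ns: "x \<notin> odd_sym" "x \<notin> odd_skew" using odd x by auto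
  have "var_poly x * skew_first m \<approx> skew_first (add_mset x m)"
    using ns cong_mult_right[OF even_word_add_even[OF x]]
    by (simp add: skew_first_def flip: mult.assoc)
  moreover have "var_poly x * sym_first m \<approx> const_poly (even_skew_sign x) * sym_first (add_mset x m)"
  proof (cases "syms m = {#}")
    case True
    then show ?thesis using ns by (simp add: sym_first_def)
  next
    case nonempty: False
    let ?w = "word_poly (splice (arrange (syms m)) (arrange (skews m)))"
    have "var_poly x * sym_first m = const_poly (mset_sign m) * (var_poly x * even_word m * ?w)"
      using nonempty by (simp add: sym_first_def const_poly_left_commute mult.assoc)
    also have "\<dots> \<approx> const_poly (mset_sign m) * (even_word (add_mset x m) * ?w)"
      by (intro cong_mult_left cong_mult_right even_word_add_even x)
    also have "\<dots> = const_poly (even_skew_sign x) * sym_first (add_mset x m)"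
      using nonempty ns
      by (simp add: sym_first_def const_poly_mult even_skew_sign_cancel)
    finally show ?thesis .
  qed
  ultimately have "const_poly a * (var_poly x * skew_first m) + const_poly b * (var_poly x * sym_first m) \<approx>
      const_poly a * skew_first (add_mset x m) +
      const_poly b * (const_poly (even_skew_sign x) * sym_first (add_mset x m))"
    by (intro cong_add cong_mult_left)
  moreover have m': "\<not> (\<forall>y\<in>#add_mset x m. var_degree y = 0)" using False by auto
  ultimately show ?thesis
    using x by (simp only: normal_form_mixed[OF False] normal_form_mixed[OF m'] letter_act_cases
        const_poly_left_commute distrib_left const_poly_mult mult.commute[of b])
qed

text \<open>Induction from the left runs parallel to the recursion of \<open>row_sums\<close>.
  Modulo \<open>I\<close> a word thus depends only on its multiset of letters and its row
  sums.\<close>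

lemma word_poly_normal_form: "word_poly xs \<approx> normal_form (mset xs) (row_sums xs)"
proof (induction xs)
  case Nil
  then show ?case by (simp add: normal_form_def even_word_def)
next
  case (Cons x xs)
  have "word_poly (x # xs) \<approx> var_poly x * normal_form (mset xs) (row_sums xs)"
    using Cons by (simp add: cong_mult_left)
  also have "\<dots> \<approx> normal_form (add_mset x (mset xs)) (letter_act x (row_sums xs))"
  proof (cases "var_degree x" rule: bit_cases)
    case 1
    then show ?thesis by (cases "row_sums xs :: 'k \<times> 'k") (simp add: normal_form_add_even)
  next
    case 2
    show ?thesis
    proof (cases "\<forall>y\<in>#mset xs. var_degree y = 0")
      case True
      then have "row_sums xs = (1, mset_sign (mset xs) :: 'k)"
        by (intro row_sums_even) auto
      then show ?thesis using normal_form_add_odd_only_evens[OF 2 True] by simp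
    next
      case False
      then show ?thesis
        using normal_form_add_odd_mixed[OF 2 False]
        by (cases "row_sums xs :: 'k \<times> 'k") simp
    qed
  qed
  finally show ?case by simp
qed

end

section \<open>From vanishing row sums to membership in the ideal\<close>

lemma normal_form_sum:
  "(\<Sum>w\<in>S. const_poly (c w) * normal_form m (p w)) =
    normal_form m (\<Sum>w\<in>S. c w * fst (p w), \<Sum>w\<in>S. c w * snd (p w))"
  by (induction S rule: infinite_finite_induct)
    (auto simp: normal_form_def single_add distrib_left distrib_right const_poly_mult)

text \<open>With the words of \<open>f\<close> grouped by their multisets of letters, linearity of
  \<open>normal_form\<close> in the pair turns each group into the normal form at
  \<open>(0, 0)\<close>.\<close>

lemma (in M11_relations) mem_if_row_sums_zero:
  fixes f :: "'k star_poly"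
  assumes "\<And>m. (\<Sum>w | w \<in> Poly_Mapping.keys f \<and> mset (letters w) = m.
      Poly_Mapping.lookup f w * fst (row_sums (letters w))) = 0"
    and "\<And>m. (\<Sum>w | w \<in> Poly_Mapping.keys f \<and> mset (letters w) = m.
      Poly_Mapping.lookup f w * snd (row_sums (letters w))) = 0"
  shows "f \<in> I"
proof -
  let ?K = "Poly_Mapping.keys f" and ?c = "Poly_Mapping.lookup f"
  let ?n = "\<lambda>w. const_poly (?c w) * normal_form (mset (letters w)) (row_sums (letters w))"
  have "f = (\<Sum>w\<in>?K. Poly_Mapping.single w (?c w))" by (rule sum_singles)
  also have "\<dots> = (\<Sum>w\<in>?K. const_poly (?c w) * word_poly (letters w))"
    by (simp add: word_poly_eq_single mult_single)
  also have "\<dots> \<approx> (\<Sum>w\<in>?K. ?n w)"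
    by (intro cong_sum cong_mult_left word_poly_normal_form)
  also have "(\<Sum>w\<in>?K. ?n w) = (\<Sum>m\<in>(\<lambda>w. mset (letters w)) ` ?K.
      \<Sum>w | w \<in> ?K \<and> mset (letters w) = m. ?n w)"
    by (rule sum.image_gen) simp
  also have "\<dots> = (\<Sum>m\<in>(\<lambda>w. mset (letters w)) ` ?K.
      \<Sum>w | w \<in> ?K \<and> mset (letters w) = m. const_poly (?c w) * normal_form m (row_sums (letters w)))"
    by (intro sum.cong) auto
  also have "\<dots> = 0"
    unfolding normal_form_sum assms by (simp add: normal_form_zero)
  finally show ?thesis by (simp add: cong_def)
qed

theorem theorem4p2:
  shows "star_identities (M11 :: ('k::field_char_0, 'k^2^2) salgebra) =
    T2_ideal hull
      ({commutator (yv 0 0) x | x. x \<in> {yv 1 0, yv 0 1, zv 0 0, zv 0 1}} \<union>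
       {yv 0 1 * yv 1 1,
        zv 0 1 * zv 1 1,
        commutator (zv 0 0) (zv 1 0),
        anticommutator (zv 0 0) (zv 0 1),
        anticommutator (zv 0 0) (yv 0 1)})"
    (is "?Id = T2_ideal hull ?G")
proof
  interpret M: star_algebra "M11 :: ('k, 'k^2^2) salgebra" by (rule star_algebra_M11)
  have "eval_poly M11 \<phi> g = 0"
    if \<phi>: "admissible (M11 :: ('k, 'k^2^2) salgebra) \<phi>" and g: "g \<in> ?G" for \<phi> g
  proof -
    \<comment> \<open>Every variable takes its values on a line, so four families of scalars
      describe \<open>\<phi>\<close> and the generators can be checked entry by entry.\<close>
    have "\<forall>i. \<exists>a. \<phi> (Y i 0) = mat2 a 0 0 a" "\<forall>i. \<exists>a. \<phi> (Z i 0) = mat2 a 0 0 (- a)"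
      "\<forall>i. \<exists>a. \<phi> (Y i 1) = mat2 0 0 a 0" "\<forall>i. \<exists>a. \<phi> (Z i 1) = mat2 0 a 0 0"
      using \<phi> M11_parts[where 'k = 'k] unfolding admissible_def by blast+
    then obtain y0 z0 y1 z1 where "\<And>i. \<phi> (Y i 0) = mat2 (y0 i) 0 0 (y0 i)"
      "\<And>i. \<phi> (Z i 0) = mat2 (z0 i) 0 0 (- z0 i)"
      "\<And>i. \<phi> (Y i 1) = mat2 0 0 (y1 i) 0" "\<And>i. \<phi> (Z i 1) = mat2 0 (z1 i) 0 0"
      by metis
    with g show ?thesis
      by (auto simp: commutator_def anticommutator_def M.eval_add M.eval_diff M.eval_mult M.eval_var
          M11_sel mat2_eq_iff matrix_mult_2)
  qed
  then have "?G \<subseteq> ?Id" unfolding star_identities_def by blast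
  then show "T2_ideal hull ?G \<subseteq> ?Id"
    by (rule hull_minimal) (rule M.T2_ideal_star_identities)
  show "?Id \<subseteq> T2_ideal hull ?G"
  proof
    fix f assume f: "f \<in> ?Id"
    have "f \<in> I" if "T2_ideal I" "?G \<subseteq> I" for I
    proof -
      interpret M11_relations I using that by unfold_locales
      show ?thesis using star_identity_row_sums[OF f] by (intro mem_if_row_sums_zero) auto
    qed
    then show "f \<in> T2_ideal hull ?G" by (auto simp: hull_def)
  qed
qed

end
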